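(* Let $C_i$ be a sequence of self-dual codes over $\mathbb{Z}_4$ all of whose Euclidean weights are divisible by $8$ (Type II), with length $n(C_i)\to\infty$. Then \[ \limsup_{i\to\infty}\frac{d_E(C_i)}{n(C_i)}\le 2-2x\;(\approx .3332625492), \] where $x$ is the positive real root of \[ 11x^{16}+2112x^{14}-8525x^{12}+15048x^{10}-15218x^8+9552x^6-3718x^4+828x^2-81. \]
   Context: Self-duality over $\mathbb{Z}_4$ is with respect to the inner product $\sum x_iy_i\bmod 4$. The Euclidean weights of $0,1,2,3\in\mathbb{Z}_4$ are $0,1,4,1$, summed over coordinates; $d_E(C)$ is the minimum Euclidean weight of a nonzero codeword of $C$. *)

theory Defs
  imports
    Complex_Main
    "HOL-Library.Numeral_Type"
    "HOL-Library.Extended_Real"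
    "Jordan_Normal_Form.Matrix"
begin

(* The numeral type 4 carries the ring structure of the integers modulo 4, so the scalar product
   of vectors over it is the sum of the products of the coordinates modulo 4. *)
type_synonym z4 = 4

definition z4_linear_code :: "nat \<Rightarrow> z4 vec set \<Rightarrow> bool" where
  "z4_linear_code n C \<longleftrightarrow>
     C \<subseteq> carrier_vec n \<and> 0\<^sub>v n \<in> C \<and>
     (\<forall>u\<in>C. \<forall>v\<in>C. u + v \<in> C) \<and> (\<forall>a. \<forall>v\<in>C. a \<cdot>\<^sub>v v \<in> C)"

definition dual_code :: "nat \<Rightarrow> z4 vec set \<Rightarrow> z4 vec set" where
  "dual_code n C = {v \<in> carrier_vec n. \<forall>c\<in>C. v \<bullet> c = 0}"

definition self_dual_code :: "nat \<Rightarrow> z4 vec set \<Rightarrow> bool" where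
  "self_dual_code n C \<longleftrightarrow> z4_linear_code n C \<and> dual_code n C = C"

definition euclidean_weight_z4 :: "z4 \<Rightarrow> nat" where
  "euclidean_weight_z4 a = (if a = 0 then 0 else if a = 2 then 4 else 1)"

definition euclidean_weight :: "z4 vec \<Rightarrow> nat" where
  "euclidean_weight v = (\<Sum>i<dim_vec v. euclidean_weight_z4 (v $ i))"

definition type_II_code :: "nat \<Rightarrow> z4 vec set \<Rightarrow> bool" where
  "type_II_code n C \<longleftrightarrow> self_dual_code n C \<and> (\<forall>c\<in>C. 8 dvd euclidean_weight c)"

(* A self-dual code of length n > 0 has 2^n elements, so the minimum is over a nonempty finite set;
   for n = 0 the value is unspecified. *)
definition min_euclidean_weight :: "nat \<Rightarrow> z4 vec set \<Rightarrow> nat" where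
  "min_euclidean_weight n C = Min (euclidean_weight ` (C - {0\<^sub>v n}))"

definition bound_poly :: "real \<Rightarrow> real" where
  "bound_poly x =
     11 * x^16 + 2112 * x^14 - 8525 * x^12 + 15048 * x^10 - 15218 * x^8
     + 9552 * x^6 - 3718 * x^4 + 828 * x^2 - 81"

end

theory Submission
  imports Defs "HOL-Computational_Algebra.Polynomial_FPS"
begin

text \<open>
  The symmetrized weight enumerator of a Type II code, restricted to the curve
  \<open>y^4 = x z (x^2 + z^2) / 2\<close> of theta constants, becomes the polynomial
  \<open>F = \<Sum> s^(wt/8) ((1 + s)/2)^(m/4)\<close> with \<open>s = (z/x)^2\<close>, where \<open>m\<close> is the number of odd
  coordinates of a codeword.  Self-duality and the divisibility of the weights make it an invariant of
  the anharmonic group, so \<open>F\<close> is a combination of the products \<open>E^(N - 3 j) D^j\<close> with \<open>3 j \<le> N = n/8\<close>,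
  where \<open>E\<close> is the analogue of the Eisenstein series of weight 4 and \<open>D\<close> that of the discriminant.
  Hence for \<open>i > N/3\<close> the \<open>i\<close>-th Lagrange coefficient of \<open>F / E^N\<close> with respect to \<open>D / E^3\<close> vanishes:
  the negative contribution of the zero word is balanced by the contributions of the nonzero words,
  which are positive when the minimum weight is close to \<open>n/3\<close>.
  Passing from \<open>i\<close> to \<open>i + L\<close> multiplies the contribution of a word roughly by the \<open>L\<close>-th power of
  \<open>E^3 / D\<close> at the saddle point of that word.  For the zero word this saddle point is the point
  \<open>s = (2 sqrt 5 - 3) / 11\<close>, and for the other words it lies to the left of the conjugate point
  with the same value of \<open>E^3 / D\<close> as soon as the minimum weight exceeds \<open>(2 - 2 x) n\<close>.  Then the positive
  contributions grow faster than the negative one, a contradiction.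
\<close>

section \<open>The root of the bound polynomial\<close>

text \<open>The number of codewords of each type is unknown, so a single vanishing Lagrange
  coefficient only balances a sum of unknown size against the zero word. Comparing the indices
  \<open>i\<close> and \<open>i + L\<close> word by word removes this obstacle, because the
  multiplicities are the same on both sides. With \<open>i\<close> about \<open>N/3\<close> and
  \<open>L\<close> a small multiple of \<open>i\<close> the gain is exponential in \<open>i\<close>,
  so constants and polynomial factors may be lost freely. Hence saddle point asymptotics can be
  replaced by two crude tools: monotonicity of \<open>F $ t * s ^ t\<close> in \<open>t\<close>, and
  bounds by values at a point.

  The constant arises as follows. A word of weight \<open>8 k\<close> is tested at the coefficient
  \<open>i - k\<close> of a series dominated by the \<open>i\<close>-th power of
  \<open>s / D\<close>, whose mean at \<open>s\<close> is \<open>i\<close> times \<tau>(s) = s (6 +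
  10 s) / (1 - s^2). With s1 the small point conjugate to the saddle point, the critical case i - k
  = i \<tau>(s1) means k / N = (1 - \<tau>(s1)) / 3, and this is 2 - 2 x. The degree 16 comes from
  eliminating \<open>sqrt 5\<close> and s1.\<close>

definition bound_poly_sq :: "real \<Rightarrow> real" where
  "bound_poly_sq w = 11 * w^8 + 2112 * w^7 - 8525 * w^6 + 15048 * w^5 - 15218 * w^4
     + 9552 * w^3 - 3718 * w^2 + 828 * w - 81"

lemma bound_poly_eq_sq: "bound_poly x = bound_poly_sq (x\<^sup>2)"
  by (simp add: bound_poly_def bound_poly_sq_def flip: power_mult)

text \<open>Taylor expansion at a point just below the root: all coefficients except the constant
  one are positive, so the polynomial increases from there on.\<close>

lemma bound_poly_sq_shift:
  "bound_poly_sq (69/100 + t) =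
     11 * t^8 + 54318/25 * t^7 + 4556497/2500 * t^6 + 134106093/125000 * t^5 + 2742346117/10000000 * t^4
     + 43679592873/1250000000 * t^3 + 346293640937/250000000000 * t^2 + 226951459779/12500000000000 * t
     - 1131637738149/10000000000000000"
  unfolding bound_poly_sq_def by Groebner_Basis.algebra
text \<open>Meant for \<open>u\<close> and \<open>v\<close> the distances of a point from the two
  ends of an interval; the \<open>c\<close>'s are then Bernstein coefficients up to binomial
  factors.\<close>

lemma bernstein8_pos:
  fixes u v :: real
  assumes "0 \<le> u" "0 \<le> v" "0 < u + v" "0 < c0" "0 < c1" "0 < c2" "0 < c3" "0 < c4" "0 < c5" "0 < c6" "0 < c7" "0 < c8"
  shows "0 < c0 * v^8 + c1 * u * v^7 + c2 * u^2 * v^6 + c3 * u^3 * v^5 + c4 * u^4 * v^4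
           + c5 * u^5 * v^3 + c6 * u^6 * v^2 + c7 * u^7 * v + c8 * u^8"
proof (cases "u = 0")
  case True
  with assms show ?thesis by simp
next
  case False
  with assms have "0 < c8 * u^8" by simp
  with assms show ?thesis
    by (intro add_nonneg_pos add_nonneg_nonneg mult_nonneg_nonneg) auto
qed

text \<open>On each of the five subintervals all Bernstein coefficients of the polynomial are negative.\<close>

lemma bound_poly_sq_neg:
  assumes "0 \<le> w" "w \<le> 69/100"
  shows "bound_poly_sq w < 0"
proof -
  have p0: "bound_poly_sq w < 0" if "0 \<le> w" "w \<le> 69/200"
  proof -
    \<comment> \<open>The factor is 69^8 / 9. Repeated bisection towards 69/100 gives subintervals
      of lengths 69/200, 69/400, 69/800, 69/1600, 69/1600; homogenizing by these lengths then leaves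
      integer coefficients in all five cases.\<close>
    have "- 57088708269849 * bound_poly_sq w =
        23040000000000000000 * (69/200 - w)^8
        + 103065600000000000000 * w * (69/200 - w)^7
        + 202215808000000000000 * w^2 * (69/200 - w)^6
        + 227586831360000000000 * w^3 * (69/200 - w)^5
        + 160517169667200000000 * w^4 * (69/200 - w)^4
        + 72540041744576000000 * w^5 * (69/200 - w)^3
        + 20494800120597000000 * w^6 * (69/200 - w)^2
        + 3310162696944489600 * w^7 * (69/200 - w)
        + 234230037932521261 * w^8"
      unfolding bound_poly_sq_def by Groebner_Basis.algebra
    also have "\<dots> > 0"
      using that by (intro bernstein8_pos) auto
    finally show ?thesis by simp
  qed
  have p1: "bound_poly_sq w < 0" if "69/200 \<le> w" "w \<le> 207/400"
  proof -
    have "- 57088708269849 * bound_poly_sq w =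
        59962889710725442816 * (207/400 - w)^8
        + 295853851319810644992 * (w - 69/200) * (207/400 - w)^7
        + 640470594800516875008 * (w - 69/200)^2 * (207/400 - w)^6
        + 796845697844275591424 * (w - 69/200)^3 * (207/400 - w)^5
        + 627122019904126045920 * (w - 69/200)^4 * (207/400 - w)^4
        + 322388984840490429504 * (w - 69/200)^5 * (207/400 - w)^3
        + 106302620198114202928 * (w - 69/200)^6 * (207/400 - w)^2
        + 20538591548815107312 * (w - 69/200)^7 * (207/400 - w)
        + 1768372964118238221 * (w - 69/200)^8"
      unfolding bound_poly_sq_def by Groebner_Basis.algebra
    also have "\<dots> > 0"
      using that by (intro bernstein8_pos) auto
    finally show ?thesis by simp
  qed
  have p2: "bound_poly_sq w < 0" if "207/400 \<le> w" "w \<le> 483/800"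
  proof -
    have "- 57088708269849 * bound_poly_sq w =
        452703478814268984576 * (483/800 - w)^8
        + 2803502027522894078976 * (w - 207/400) * (483/800 - w)^7
        + 7719819816370750788352 * (w - 207/400)^2 * (483/800 - w)^6
        + 12257417527881156204288 * (w - 207/400)^3 * (483/800 - w)^5
        + 12157546671397140829920 * (w - 207/400)^4 * (483/800 - w)^4
        + 7633096537383394937792 * (w - 207/400)^5 * (483/800 - w)^3
        + 2934809171116678308912 * (w - 207/400)^6 * (483/800 - w)^2
        + 628032240789099634704 * (w - 207/400)^7 * (483/800 - w)
        + 57168567901914975661 * (w - 207/400)^8"
      unfolding bound_poly_sq_def by Groebner_Basis.algebra
    also have "\<dots> > 0"
      using that by (intro bernstein8_pos) auto
    finally show ?thesis by simp
  qed
  have p3: "bound_poly_sq w < 0" if "483/800 \<le> w" "w \<le> 207/320"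
  proof -
    have "- 57088708269849 * bound_poly_sq w =
        14635153382890233769216 * (207/320 - w)^8
        + 95233713773678051988480 * (w - 483/800) * (207/320 - w)^7
        + 265767118453002230188800 * (w - 483/800)^2 * (207/320 - w)^6
        + 413895990440717659616000 * (w - 483/800)^3 * (207/320 - w)^5
        + 392250386712904730700000 * (w - 483/800)^4 * (207/320 - w)^4
        + 231439007516374404600000 * (w - 483/800)^5 * (207/320 - w)^3
        + 83375773604986036750000 * (w - 483/800)^6 * (207/320 - w)^2
        + 17001194483545211250000 * (w - 483/800)^7 * (207/320 - w)
        + 1541473432556305078125 * (w - 483/800)^8"
      unfolding bound_poly_sq_def by Groebner_Basis.algebra
    also have "\<dots> > 0"
      using that by (intro bernstein8_pos) auto
    finally show ?thesis by simp
  qed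
  have p4: "bound_poly_sq w < 0" if "207/320 \<le> w" "w \<le> 69/100"
  proof -
    have "- 57088708269849 * bound_poly_sq w =
        1541473432556305078125 * (69/100 - w)^8
        + 7662380437355670000000 * (w - 207/320) * (69/100 - w)^7
        + 18004075281659248000000 * (w - 207/320)^2 * (69/100 - w)^6
        + 31550036910884966400000 * (w - 207/320)^3 * (69/100 - w)^5
        + 46522516918725427200000 * (w - 207/320)^4 * (69/100 - w)^4
        + 48322059760890281984000 * (w - 207/320)^5 * (69/100 - w)^3
        + 28983219003623001292800 * (w - 207/320)^6 * (69/100 - w)^2
        + 8056846719438783774720 * (w - 207/320)^7 * (69/100 - w)
        + 540038564029929619456 * (w - 207/320)^8"
      unfolding bound_poly_sq_def by Groebner_Basis.algebra
    also have "\<dots> > 0"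
      using that by (intro bernstein8_pos) auto
    finally show ?thesis by simp
  qed
  from assms show ?thesis
    using p0 p1 p2 p3 p4 by linarith
qed

lemma bound_poly_sq_strict_mono:
  assumes "69/100 \<le> w" "w < w'"
  shows "bound_poly_sq w < bound_poly_sq w'"
proof -
  define t where "t = w - 69/100"
  define t' where "t' = w' - 69/100"
  have t: "w = 69/100 + t" "w' = 69/100 + t'" "0 \<le> t" "t < t'"
    using assms by (auto simp: t_def t'_def)
  have "t^k < t'^k" if "k > 0" for k
    using t that by (intro power_strict_mono) auto
  note this[of 2] this[of 3] this[of 4] this[of 5] this[of 6] this[of 7] this[of 8]
  then show ?thesis
    using t(4) unfolding t(1,2) bound_poly_sq_shift by linarith
qed

lemma bound_poly_root_unique:
  assumes "0 < x" "0 < y" "bound_poly x = 0" "bound_poly y = 0"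
  shows "y = x"
proof -
  have ge: "69/100 < z\<^sup>2" if "bound_poly z = 0" for z
    using bound_poly_sq_neg[of "z\<^sup>2"] that by (force simp: bound_poly_eq_sq)
  have "x\<^sup>2 = y\<^sup>2"
    using bound_poly_sq_strict_mono[of "x\<^sup>2" "y\<^sup>2"] bound_poly_sq_strict_mono[of "y\<^sup>2" "x\<^sup>2"]
      ge[of x] ge[of y] assms
    by (cases "x\<^sup>2" "y\<^sup>2" rule: linorder_cases) (auto simp: bound_poly_eq_sq)
  with assms show ?thesis by simp
qed

lemma bound_poly_sq_horner:
  "bound_poly_sq (69/100 + t) =
     (((((((11 * t + 54318/25) * t + 4556497/2500) * t + 134106093/125000) * t + 2742346117/10000000) * t
     + 43679592873/1250000000) * t + 346293640937/250000000000) * t + 226951459779/12500000000000) * t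
     - 1131637738149/10000000000000000"
  unfolding bound_poly_sq_shift by Groebner_Basis.algebra

lemma bound_poly_root_approx:
  assumes "0 < x" "bound_poly x = 0"
  shows "\<bar>(2 - 2 * x) - 0.3332625492\<bar> < 1 / 10 ^ 10"
proof -
  have ge: "69/100 < x\<^sup>2"
    using bound_poly_sq_neg[of "x\<^sup>2"] assms by (force simp: bound_poly_eq_sq)
  have less: "w < w'" if "bound_poly_sq w < bound_poly_sq w'" "69/100 \<le> w'" for w w'
    using bound_poly_sq_strict_mono[of w' w] that by (cases w w' rule: linorder_cases) auto
  \<comment> \<open>The bounds for \<open>x\<close> are the two numbers at which 2 - 2 x is exactly
    10^(-10) away from the given decimal. The argument here lies between the square of the lower one
    and the root; the one below plays the same role for the upper bound.\<close>
  have "bound_poly_sq (69/100 + 45034324/10^10) < 0"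
    unfolding bound_poly_sq_horner by simp
  with assms ge have "69/100 + 45034324/10^10 < x\<^sup>2"
    by - (rule less, simp_all add: bound_poly_eq_sq)
  moreover have "(83336872535 / 10^11)\<^sup>2 < (69/100 + 45034324/10^10 :: real)"
    by (simp add: power_divide)
  ultimately have "(83336872535 / 10^11)\<^sup>2 < x\<^sup>2" by (rule less_trans[rotated])
  then have 1: "83336872535 / 10^11 < x"
    by (rule power_less_imp_less_base) (use assms(1) in simp)
  have "bound_poly_sq (69/100 + 450343255/10^11) > 0"
    unfolding bound_poly_sq_horner by simp
  with assms have "x\<^sup>2 < 69/100 + 450343255/10^11"
    by - (rule less, simp_all add: bound_poly_eq_sq)
  also have "(69/100 + 450343255/10^11 :: real) < (83336872545 / 10^11)\<^sup>2"
    by (simp add: power_divide)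
  finally have 2: "x < 83336872545 / 10^11"
    by (rule power_less_imp_less_base) simp
  show ?thesis using 1 2 unfolding abs_less_iff by simp
qed

section \<open>The point conjugate to the saddle point, and the origin of the polynomial\<close>

definition eis :: "real \<Rightarrow> real" where
  "eis s = 1 + 60 * s + 134 * s^2 + 60 * s^3 + s^4"

text \<open>With s = V^2 and \<lambda> = ((1 - V) / (1 + V))^4, \<open>eis\<close> is 1 - \<lambda>
  + \<lambda>^2 times (1 + V)^8, and \<open>cusp\<close> is (\<lambda> (1 - \<lambda>))^2 times (1 +
  V)^24 / 64. For length 8, \<open>eis\<close> is the polynomial F of every Type II code.\<close>

definition cusp :: "real \<Rightarrow> real" where
  "cusp s = s * (1 + s)^2 * (1 - s)^8"

text \<open>The positive root of 11 t^2 + 6 t = 1, the critical point of \<open>cusp\<close> in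
  (0,1); there \<open>phi s / s\<close>, the reciprocal of \<open>cusp\<close>, is minimal.\<close>

definition saddle :: real where
  "saddle = (2 * sqrt 5 - 3) / 11"

text \<open>The cubic in \<open>z\<close> has one root from \<open>saddle\<close> and one small
  positive root, since the constant term of \<open>Q\<close> is slightly negative (9 sqrt 5 > 19).
  The latter gives \<open>s\<close>. The equation for 6 x - 5 is what turns the critical ratio (1 -
  \<tau>(s)) / 3 into 2 - 2 x.\<close>

lemma obtain_conjugate_point:
  obtains s x :: real where "0 < s" "s < 1/1000" "0 < x" "bound_poly x = 0"
    "6 * x - 5 = s * (6 + 10 * s) / (1 - s\<^sup>2)"
    "eis s ^ 3 * cusp saddle = eis saddle ^ 3 * cusp s"
proof -
  define r where "r = sqrt 5"
  have r2: "r * r = 5" by (simp add: r_def)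
  have r_bds: "2236/1000 < r" "r < 2237/1000"
    using real_less_rsqrt[of "2236/1000" 5] real_less_lsqrt[of "2237/1000" 5]
    by (simp_all add: r_def power2_eq_square)
  \<comment> \<open>In the coordinate \<open>z = 4 s (1 + s)^2 / (1 - s)^4\<close> the quotient of \<open>eis^3\<close> and \<open>cusp\<close> is
     \<open>4 (16 z + 1)^3 / z\<close>; \<open>Q\<close> is what remains of the cubic for its value at \<open>saddle\<close> after removing
     the root \<open>z0\<close> that belongs to \<open>saddle\<close>.\<close>
  define Q where "Q z = z^2 + (25 + 9 * r) / 32 * z + (19 - 9 * r) / 5632" for z
  define Z where "Z s = 4 * s * (1 + s)^2 / (1 - s)^4" for s :: real
  have "\<exists>s\<ge>0. s \<le> 1/10000 \<and> Q (Z s) = 0"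
  proof (rule IVT)
    show "Q (Z 0) \<le> 0" using r_bds by (simp add: Q_def Z_def)
    have "Z (1/10000) \<ge> 4 / 10000" by (simp add: Z_def field_simps)
    then have "(25 + 9 * r) / 32 * Z (1/10000) \<ge> 1 * (4 / 10000)"
      using r_bds by (intro mult_mono) auto
    moreover have "(19 - 9 * r) / 5632 \<ge> - 3 / 10000" using r_bds by simp
    ultimately show "0 \<le> Q (Z (1/10000))" unfolding Q_def
      using zero_le_power2[of "Z (1/10000)"] by linarith
    show "\<forall>s. 0 \<le> s \<and> s \<le> 1/10000 \<longrightarrow> isCont (\<lambda>s. Q (Z s)) s"
      unfolding Q_def Z_def by (auto intro!: continuous_intros)
  qed auto
  then obtain s where s: "0 \<le> s" "s \<le> 1/10000" "Q (Z s) = 0" by blast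
  have "s \<noteq> 0" using s(3) r_bds by (auto simp: Q_def Z_def)
  define z where "z = Z s"
  define z0 where "z0 = (19 + 9 * r) / 32"
  define s0 where "s0 = (2 * r - 3) / 11"
  have z0: "z0 * (1 - s0)^4 = 4 * s0 * (1 + s0)^2"
  proof -
    have "11 * s0\<^sup>2 + 6 * s0 = 1" "64 * z0 = 65 + 99 * s0"
      using r2 by (simp_all add: s0_def z0_def power2_eq_square algebra_simps add_divide_distrib diff_divide_distrib)
    then show ?thesis by Groebner_Basis.algebra
  qed
  have z: "z * (1 - s)^4 = 4 * s * (1 + s)^2"
    using s unfolding z_def Z_def by simp
  have cubic: "(16 * z + 1)^3 * z0 = (16 * z0 + 1)^3 * z"
    using s(3) r2 unfolding Q_def z_def[symmetric] z0_def by Groebner_Basis.algebra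
  have e: "eis t = (16 * y + 1) * (1 - t)^4" "4 * cusp t = y * (1 - t)^12"
    if "y * (1 - t)^4 = 4 * t * (1 + t)^2" for y t
    using that unfolding eis_def cusp_def by Groebner_Basis.algebra+
  have inv: "eis s ^ 3 * cusp s0 = eis s0 ^ 3 * cusp s"
    using e[OF z] e[OF z0] cubic by Groebner_Basis.algebra
  \<comment> \<open>the product of \<open>Q\<close> and its conjugate under \<open>sqrt 5 \<mapsto> - sqrt 5\<close>\<close>
  have N: "z^4 + 25/16 * z^3 + 39/176 * z^2 + 5/512 * z - 1/720896 = 0"
    using s(3) r2 unfolding Q_def z_def[symmetric] by Groebner_Basis.algebra
  \<comment> \<open>In terms of \<open>Y\<close> one has z = Y^2 (Y^2 - 1), and s (6 + 10 s) / (1 -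
    s^2) becomes 4 Y - 5 + 1 / Y. So 6 x has to be 4 Y + 1 / Y.\<close>
  define Y where "Y = (1 + s) / (1 - s)"
  define x where "x = (4 * Y^2 + 1) / (6 * Y)"
  have Y: "Y * (1 - s) = 1 + s" "Y > 0" using s by (auto simp: Y_def)
  have "(Y^2 * (Y^2 - 1)) * (1 - s)^4 = 4 * s * (1 + s)^2"
    using Y(1) by Groebner_Basis.algebra
  then have "z * (1 - s)^4 = (Y^2 * (Y^2 - 1)) * (1 - s)^4"
    using z by simp
  then have zY: "z = Y^2 * (Y^2 - 1)"
    using s by (subst (asm) mult_right_cancel) auto
  define y where "y = Y^2"
  have "bound_poly_sq (x\<^sup>2) * (36 * Y^2)^8 = 0"
  proof -
    have "x\<^sup>2 * (36 * Y^2) = (4 * Y^2 + 1)^2" using Y unfolding x_def by (simp add: field_simps)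
    then have "bound_poly_sq (x\<^sup>2) * (36 * Y^2)^8 =
        11 * ((4 * Y^2 + 1)^2)^8 + 2112 * ((4 * Y^2 + 1)^2)^7 * (36 * Y^2)
        - 8525 * ((4 * Y^2 + 1)^2)^6 * (36 * Y^2)^2 + 15048 * ((4 * Y^2 + 1)^2)^5 * (36 * Y^2)^3
        - 15218 * ((4 * Y^2 + 1)^2)^4 * (36 * Y^2)^4 + 9552 * ((4 * Y^2 + 1)^2)^3 * (36 * Y^2)^5
        - 3718 * ((4 * Y^2 + 1)^2)^2 * (36 * Y^2)^6 + 828 * ((4 * Y^2 + 1)^2) * (36 * Y^2)^7
        - 81 * (36 * Y^2)^8"
      unfolding bound_poly_sq_def by Groebner_Basis.algebra
    \<comment> \<open>The expression (4 y + 1)^2 / (36 y) for x^2 does not change under y -> 1 / (16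
      y). Hence the quartic in z = y (y - 1) appears twice: as it stands, and with 1 / (16 y) for
      \<open>y\<close>, which up to a constant and a power of \<open>y\<close> is the second
      factor.\<close>
    also have "\<dots> = (z^4 + 25/16 * z^3 + 39/176 * z^2 + 5/512 * z - 1/720896) *
       (47244640256 * y^8 + 20787641712640 * y^7 - 30779883126784 * y^6 + 16677358010368 * y^5
        - 3070901616640 * y^4 + 282175995904 * y^3 - 15352201216 * y^2 + 507510784 * y - 7929856)"
      unfolding zY y_def[symmetric] by Groebner_Basis.algebra
    finally show ?thesis using N by simp
  qed
  then have root: "bound_poly x = 0" using Y by (simp add: bound_poly_eq_sq)
  have "s < 1" "s > 0" using s \<open>s \<noteq> 0\<close> by auto
  then have "s * s \<noteq> 1" by (auto simp: square_eq_1_iff)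
  then have "6 * x - 5 = s * (6 + 10 * s) / (1 - s\<^sup>2)"
    using \<open>s < 1\<close> \<open>s > 0\<close> unfolding x_def Y_def
    by (simp add: divide_simps power2_eq_square) Groebner_Basis.algebra
  moreover have "x > 0" using Y unfolding x_def by (intro divide_pos_pos add_nonneg_pos) auto
  ultimately show thesis
    using that[of s x] root inv \<open>s > 0\<close> s(2) by (simp add: s0_def r_def saddle_def)
qed

section \<open>Coefficient growth of power series\<close>

no_notation vec_index (infixl \<open>$\<close> 100)
unbundle fps_syntax

definition nonneg_fps :: "real fps \<Rightarrow> bool" where
  "nonneg_fps F \<longleftrightarrow> (\<forall>n. 0 \<le> F $ n)"

text \<open>Convergence and value in one relation, so that the values of sums and products are
  computed by introduction rules.\<close>

definition fps_has_value :: "real fps \<Rightarrow> real \<Rightarrow> real \<Rightarrow> bool" where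
  "fps_has_value F s v \<longleftrightarrow> (\<lambda>n. F $ n * s ^ n) sums v"

text \<open>For s > 0 this says that the weights \<open>F $ t * s ^ t\<close> do not decrease up to
  \<open>m\<close>. It is the substitute for knowing that the saddle point of the coefficient
  \<open>m\<close> is at least \<open>s\<close>.\<close>

definition geometric_upto :: "real fps \<Rightarrow> real \<Rightarrow> nat \<Rightarrow> bool" where
  "geometric_upto F s m \<longleftrightarrow> (\<forall>t<m. F $ t \<le> s * F $ Suc t)"

lemma nonneg_fps_nth: "nonneg_fps F \<Longrightarrow> 0 \<le> F $ n"
  by (simp add: nonneg_fps_def)

lemma nonneg_fps_add: "nonneg_fps F \<Longrightarrow> nonneg_fps G \<Longrightarrow> nonneg_fps (F + G)"
  by (simp add: nonneg_fps_def)

lemma nonneg_fps_mult: "nonneg_fps F \<Longrightarrow> nonneg_fps G \<Longrightarrow> nonneg_fps (F * G)"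
  by (auto simp: nonneg_fps_def fps_mult_nth intro!: sum_nonneg)

lemma nonneg_fps_basic [simp]:
  "nonneg_fps 1" "nonneg_fps fps_X" "nonneg_fps (numeral k)" "nonneg_fps (of_nat j)"
  "0 \<le> c \<Longrightarrow> nonneg_fps (fps_const c)"
  by (auto simp: nonneg_fps_def numeral_fps_const simp flip: fps_of_nat)

lemma nonneg_fps_power: "nonneg_fps F \<Longrightarrow> nonneg_fps (F ^ k)"
  by (induction k) (auto intro: nonneg_fps_mult)

lemma nonneg_fps_deriv: "nonneg_fps F \<Longrightarrow> nonneg_fps (fps_deriv F)"
  by (auto simp: nonneg_fps_def)

lemmas nonneg_fps_intros = nonneg_fps_add nonneg_fps_mult nonneg_fps_power nonneg_fps_deriv nonneg_fps_basic

lemma fps_has_value_basic: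
  "fps_has_value 1 s 1" "fps_has_value (fps_const c) s c" "fps_has_value fps_X s s"
  "fps_has_value (numeral k) s (numeral k)"
proof -
  show c: "fps_has_value (fps_const c) s c" for c
  proof -
    have "(\<lambda>n. fps_const c $ n * s ^ n) = (\<lambda>n. if n = 0 then c else 0)" by auto
    then show ?thesis using sums_single[of 0 "\<lambda>_. c"] by (simp add: fps_has_value_def)
  qed
  show "fps_has_value 1 s 1" using c[of 1] by simp
  show "fps_has_value (numeral k) s (numeral k)" using c[of "numeral k"] by (simp add: numeral_fps_const)
  show "fps_has_value fps_X s s"
    using sums_single[of 1 "\<lambda>n. s ^ n"]
    by (simp add: fps_has_value_def fps_X_def if_distrib[of "\<lambda>x. x * _"] cong: if_cong)
qed

lemma fps_has_value_add:
  "fps_has_value F s a \<Longrightarrow> fps_has_value G s b \<Longrightarrow> fps_has_value (F + G) s (a + b)"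
  unfolding fps_has_value_def by (drule (1) sums_add) (simp add: algebra_simps)

lemma fps_has_value_mult:
  assumes "nonneg_fps F" "nonneg_fps G" "0 \<le> s" "fps_has_value F s a" "fps_has_value G s b"
  shows "fps_has_value (F * G) s (a * b)"
proof -
  let ?f = "\<lambda>n. F $ n * s ^ n" and ?g = "\<lambda>n. G $ n * s ^ n"
  have f: "?f sums a" and g: "?g sums b" using assms by (simp_all add: fps_has_value_def)
  have "summable (\<lambda>n. norm (?f n))" "summable (\<lambda>n. norm (?g n))"
    using sums_summable[OF f] sums_summable[OF g] assms by (simp_all add: nonneg_fps_def)
  then have "(\<lambda>k. \<Sum>i\<le>k. ?f i * ?g (k - i)) sums ((\<Sum>k. ?f k) * (\<Sum>k. ?g k))"
    by (rule Cauchy_product_sums)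
  moreover have "(\<Sum>i\<le>k. ?f i * ?g (k - i)) = (F * G) $ k * s ^ k" for k
    unfolding fps_mult_nth sum_distrib_right atLeast0AtMost
    by (rule sum.cong) (auto simp: algebra_simps simp flip: power_add)
  ultimately show ?thesis
    using sums_unique[OF f] sums_unique[OF g] by (simp add: fps_has_value_def)
qed

lemma fps_has_value_power:
  assumes "nonneg_fps F" "0 \<le> s" "fps_has_value F s a"
  shows "fps_has_value (F ^ k) s (a ^ k)"
  using assms by (induction k) (auto intro!: fps_has_value_mult nonneg_fps_intros fps_has_value_basic)

lemma fps_partial_sum_le:
  assumes "nonneg_fps F" "0 \<le> s" "fps_has_value F s a"
  shows "(\<Sum>l\<le>n. F $ l * s ^ l) \<le> a"
proof -
  have "(\<Sum>l\<in>{..n}. F $ l * s ^ l) \<le> (\<Sum>l. F $ l * s ^ l)"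
    using assms by (intro sum_le_suminf) (auto simp: fps_has_value_def nonneg_fps_def sums_summable)
  with assms show ?thesis by (simp add: fps_has_value_def sums_iff)
qed

lemma fps_nth_le_value:
  assumes "nonneg_fps F" "0 < s" "fps_has_value F s a"
  shows "F $ n \<le> a / s ^ n"
proof -
  have "F $ n * s ^ n \<le> (\<Sum>l\<le>n. F $ l * s ^ l)"
    using assms by (intro member_le_sum) (auto simp: nonneg_fps_def)
  also have "\<dots> \<le> a" using assms by (intro fps_partial_sum_le) auto
  finally show ?thesis using assms by (simp add: field_simps)
qed

text \<open>A Chernoff bound: passing from \<open>s\<close> to \<open>r\<close> inflates every term
  of degree at least \<open>n\<close> by at least the factor (r / s)^n.\<close>

lemma fps_partial_sum_ge:
  assumes "nonneg_fps F" "0 \<le> s" "s < r" "fps_has_value F s a" "fps_has_value F r b"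
  shows "a - (s / r) ^ n * b \<le> (\<Sum>l<n. F $ l * s ^ l)"
proof -
  have sm: "summable (\<lambda>l. F $ l * s ^ l)" "summable (\<lambda>l. F $ l * r ^ l)"
    using assms by (auto simp: fps_has_value_def sums_summable)
  have shift: "summable (\<lambda>l. F $ (l + n) * s ^ (l + n))" "summable (\<lambda>l. F $ (l + n) * r ^ (l + n))"
    using sm[THEN summable_ignore_initial_segment, of n] by auto
  have "a = (\<Sum>l. F $ (l + n) * s ^ (l + n)) + (\<Sum>l<n. F $ l * s ^ l)"
    using suminf_split_initial_segment[OF sm(1), of n] assms by (simp add: fps_has_value_def sums_iff)
  moreover have "(\<Sum>l. F $ (l + n) * s ^ (l + n)) \<le> (\<Sum>l. (s / r) ^ n * (F $ (l + n) * r ^ (l + n)))"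
  proof (rule suminf_le)
    fix l
    have "s ^ (l + n) = (s / r) ^ n * (s ^ l * r ^ n)"
      using assms by (simp add: power_add power_divide)
    also have "\<dots> \<le> (s / r) ^ n * (r ^ l * r ^ n)"
      using assms by (intro mult_left_mono mult_right_mono power_mono) auto
    finally have "F $ (l + n) * s ^ (l + n) \<le> F $ (l + n) * ((s / r) ^ n * (r ^ l * r ^ n))"
      using assms by (intro mult_left_mono) (auto simp: nonneg_fps_def)
    then show "F $ (l + n) * s ^ (l + n) \<le> (s / r) ^ n * (F $ (l + n) * r ^ (l + n))"
      by (simp add: power_add mult_ac)
  qed (auto intro!: summable_mult shift)
  moreover have "(\<Sum>l. (s / r) ^ n * (F $ (l + n) * r ^ (l + n))) \<le> (s / r) ^ n * b"
  proof -
    have "(\<Sum>l. F $ (l + n) * r ^ (l + n)) = b - (\<Sum>l<n. F $ l * r ^ l)"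
      using suminf_split_initial_segment[OF sm(2), of n] assms by (simp add: fps_has_value_def sums_iff)
    also have "\<dots> \<le> b" using assms by (auto intro!: sum_nonneg simp: nonneg_fps_def)
    finally show ?thesis
      using assms by (subst suminf_mult[OF shift(2)]) (auto intro!: mult_left_mono)
  qed
  ultimately show ?thesis by linarith
qed

text \<open>Every shift of \<open>F\<close> satisfies the inequality, and the one additional term of
  the convolution at \<open>Suc t\<close> is nonnegative.\<close>

lemma geometric_upto_mult:
  assumes "geometric_upto F s m" "nonneg_fps F" "nonneg_fps H" "0 \<le> s"
  shows "geometric_upto (H * F) s m"
  unfolding geometric_upto_def
proof (intro allI impI)
  fix t assume "t < m"
  have "(H * F) $ t = (\<Sum>l\<le>t. H $ l * F $ (t - l))"
    by (simp add: fps_mult_nth atLeast0AtMost)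
  also have "\<dots> \<le> (\<Sum>l\<le>t. H $ l * (s * F $ (Suc t - l)))"
  proof (intro sum_mono mult_left_mono)
    fix l assume "l \<in> {..t}"
    then show "F $ (t - l) \<le> s * F $ (Suc t - l)"
      using assms(1) \<open>t < m\<close> by (simp add: geometric_upto_def Suc_diff_le)
  qed (use assms in \<open>auto simp: nonneg_fps_def\<close>)
  also have "\<dots> = s * (\<Sum>l\<le>t. H $ l * F $ (Suc t - l))"
    by (simp add: sum_distrib_left mult_ac)
  also have "\<dots> \<le> s * (\<Sum>l\<le>Suc t. H $ l * F $ (Suc t - l))"
    using assms by (intro mult_left_mono) (auto simp: nonneg_fps_def)
  also have "\<dots> = s * (H * F) $ Suc t"
    by (simp add: fps_mult_nth atLeast0AtMost)
  finally show "(H * F) $ t \<le> s * (H * F) $ Suc t" .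
qed

lemma geometric_upto_iterate:
  assumes "geometric_upto F s m" "0 \<le> s" "t + l \<le> m"
  shows "F $ t \<le> s ^ l * F $ (t + l)"
  using assms(3)
proof (induction l)
  case (Suc l)
  then have "F $ t \<le> s ^ l * F $ (t + l)" by simp
  also have "\<dots> \<le> s ^ l * (s * F $ Suc (t + l))"
    using assms Suc.prems by (intro mult_left_mono) (auto simp: geometric_upto_def)
  finally show ?case by (simp add: mult_ac)
qed simp

text \<open>Going back \<open>l\<close> places costs a factor of at most s^l, so the convolution is
  dominated by the power series of \<open>H\<close> at \<open>s\<close>.\<close>

lemma geometric_upto_mult_nth_le:
  assumes "geometric_upto F s m" "nonneg_fps F" "nonneg_fps H" "0 \<le> s" "fps_has_value H s v" "t \<le> m"
  shows "(H * F) $ t \<le> v * F $ t"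
proof -
  have "(H * F) $ t = (\<Sum>l\<le>t. H $ l * F $ (t - l))"
    by (simp add: fps_mult_nth atLeast0AtMost)
  also have "\<dots> \<le> (\<Sum>l\<le>t. H $ l * (s ^ l * F $ t))"
  proof (intro sum_mono mult_left_mono)
    fix l assume "l \<in> {..t}"
    then show "F $ (t - l) \<le> s ^ l * F $ t"
      using geometric_upto_iterate[OF assms(1,4), of "t - l" l] assms(6) by simp
  qed (use assms in \<open>auto simp: nonneg_fps_def\<close>)
  also have "\<dots> = (\<Sum>l\<le>t. H $ l * s ^ l) * F $ t"
    by (simp add: sum_distrib_left mult_ac)
  also have "\<dots> \<le> v * F $ t"
    using assms by (intro mult_right_mono fps_partial_sum_le) (auto simp: nonneg_fps_def)
  finally show ?thesis .
qed

text \<open>The converse estimate: going forward n - l places gains at least s^(l - n). Only the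
  terms of \<open>H\<close> up to degree \<open>n\<close> can be used, which is why a partial sum of
  its value appears.\<close>

lemma geometric_upto_mult_nth_ge:
  assumes "geometric_upto F s m" "nonneg_fps F" "nonneg_fps H" "0 < s" "t + n \<le> m"
  shows "(\<Sum>l\<le>n. H $ l * s ^ l) / s ^ n * F $ t \<le> (H * F) $ (t + n)"
proof -
  have "(\<Sum>l\<le>n. H $ l * s ^ l) / s ^ n * F $ t = (\<Sum>l\<le>n. H $ l * (F $ t / s ^ (n - l)))"
    using assms(4) by (auto simp: sum_distrib_right sum_divide_distrib power_diff intro!: sum.cong)
  also have "\<dots> \<le> (\<Sum>l\<le>n. H $ l * F $ (t + n - l))"
  proof (intro sum_mono mult_left_mono)
    fix l assume "l \<in> {..n}"
    then show "F $ t / s ^ (n - l) \<le> F $ (t + n - l)"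
      using geometric_upto_iterate[OF assms(1), of t "n - l"] assms(4,5) by (simp add: field_simps)
  qed (use assms in \<open>auto simp: nonneg_fps_def\<close>)
  also have "\<dots> \<le> (\<Sum>l\<le>t + n. H $ l * F $ (t + n - l))"
    using assms by (intro sum_mono2) (auto simp: nonneg_fps_def)
  also have "\<dots> = (H * F) $ (t + n)"
    by (simp add: fps_mult_nth atLeast0AtMost)
  finally show ?thesis .
qed

text \<open>
  The recurrence holds for the coefficients of \<open>g\<close> with \<open>(1 - s^2) g' = (A + B s) g\<close>, and \<open>T\<close> is the
  logarithmic derivative \<open>s g' / g\<close> at \<open>s\<close>, that is, the mean of the distribution \<open>g t * s^t\<close>: up to two
  steps below the mean the weights \<open>g t * s^t\<close> increase.
\<close>

lemma recurrence_geometric: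
  fixes g :: "nat \<Rightarrow> real"
  assumes nonneg: "\<And>t. 0 \<le> g t"
    and rec0: "g 1 = A * g 0"
    and rec: "\<And>t. t \<ge> 1 \<Longrightarrow> real (t + 1) * g (t + 1) = A * g t + (B + real t - 1) * g (t - 1)"
    and s: "0 < s" "s \<le> 3/20" and B: "0 \<le> B" "B \<le> 5/3 * A"
    and T: "T * (1 - s\<^sup>2) = s * (A + B * s)"
    and t: "real t + 2 \<le> T"
  shows "g t \<le> s * g (t + 1)"
  using t
proof (induction t rule: less_induct)
  case (less t)
  have A: "0 \<le> A" using B by linarith
  have s2: "s\<^sup>2 \<le> 3/20 * s" using s by (simp add: power2_eq_square mult_right_mono)
  have T': "s * A + s\<^sup>2 * (B + T) = T" using T by Groebner_Basis.algebra
  have T_pos: "0 < T" using less.prems by linarith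
  have sA: "s * A \<le> T"
  proof -
    have "0 \<le> s\<^sup>2 * (B + T)" using B T_pos by simp
    with T' show ?thesis by linarith
  qed
  have sB: "s\<^sup>2 * B \<le> 5/3 * s * T"
  proof -
    have "s\<^sup>2 * B \<le> s\<^sup>2 * (5/3 * A)" using B by (intro mult_left_mono) auto
    also have "\<dots> = 5/3 * s * (s * A)" by (simp add: power2_eq_square)
    also have "\<dots> \<le> 5/3 * s * T"
      using sA s by (intro mult_left_mono) auto
    finally show ?thesis .
  qed
  show ?case
  proof (cases "t = 0")
    case True
    have "1 \<le> s * A"
    proof -
      have "5/3 * s * T + s\<^sup>2 * T \<le> 1/4 * T + 9/400 * T"
        using s s2 T_pos by (intro add_mono mult_right_mono) auto
      with T' sB less.prems True show ?thesis by (simp add: algebra_simps)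
    qed
    then have "1 * g 0 \<le> s * A * g 0" using nonneg by (intro mult_right_mono)
    with True show ?thesis by (simp add: rec0[unfolded One_nat_def])
  next
    case False
    \<comment> \<open>An upper bound for \<open>g t\<close>, from the recurrence one step lower and
      the induction hypothesis at \<open>t - 2\<close>. Read backwards it bounds
      \<open>g (t - 1)\<close> from below, as the recurrence for \<open>g (t + 1)\<close>
      requires.\<close>
    have "real t * g t \<le> T / s * g (t - 1)"
    proof (cases "t = 1")
      case True
      have "A \<le> T / s" using sA s by (simp add: field_simps)
      then have "A * g 0 \<le> T / s * g 0" using nonneg by (rule mult_right_mono)
      with True show ?thesis by (simp add: rec0[unfolded One_nat_def])
    next
      case False
      with \<open>t \<noteq> 0\<close> have t2: "t \<ge> 2" by simp
      have IH: "g (t - 2) \<le> s * g (t - 1)"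
        using less.IH[of "t - 2"] less.prems t2 by (simp add: numeral_2_eq_2 Suc_diff_Suc)
      have "real t * g t = A * g (t - 1) + (B + real t - 2) * g (t - 2)"
        using rec[of "t - 1"] t2 by (simp add: numeral_2_eq_2)
      also have "\<dots> \<le> A * g (t - 1) + (B + real t - 2) * (s * g (t - 1))"
        using IH t2 B by (intro add_left_mono mult_left_mono) auto
      also have "\<dots> = (A + (B + real t - 2) * s) * g (t - 1)" by (simp add: algebra_simps)
      also have "\<dots> \<le> (A + (B + T) * s) * g (t - 1)"
        using less.prems s nonneg by (intro mult_right_mono add_left_mono) auto
      also have "A + (B + T) * s = T / s" using T' s by (simp add: field_simps power2_eq_square)
      finally show ?thesis .
    qed
    then have prev: "real t * s / T * g t \<le> g (t - 1)"
      using s T_pos by (simp add: field_simps)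
    define D where "D = T - real t"
    have D: "2 \<le> D" "real t = T - D" using less.prems by (auto simp: D_def)
    \<comment> \<open>In terms of the distance D from the mean, the right side is T minus losses of
      at most (1/4 + 9/400) D + 9/400 (D + 1), by s \<le> 3/20 and B \<le> 5/3 A. The left side is T
      - (D - 1), and D \<ge> 2 leaves enough room.\<close>
    have key: "real (t + 1) \<le> s * (A + (B + real t - 1) * (real t * s / T))"
    proof -
      have "s * (A + (B + real t - 1) * (real t * s / T)) = s * A + s\<^sup>2 * (B + real t - 1) * (real t / T)"
        by (simp add: power2_eq_square distrib_left mult_ac)
      also have "real t / T = 1 - D / T" using D T_pos by (simp add: field_simps)
      also have "s\<^sup>2 * (B + real t - 1) * (1 - D / T) = s\<^sup>2 * (B + real t - 1) - s\<^sup>2 * (B + real t - 1) / T * D"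
        by (simp add: right_diff_distrib)
      also have "s * A + \<dots> = s * A + (s\<^sup>2 * (B + T) - s\<^sup>2 * (D + 1) - s\<^sup>2 * (B + real t - 1) / T * D)"
      proof -
        have "s\<^sup>2 * (B + real t - 1) = s\<^sup>2 * (B + T) - s\<^sup>2 * (D + 1)"
          unfolding D(2) by (simp add: algebra_simps)
        then show ?thesis by simp
      qed
      finally have eq: "s * (A + (B + real t - 1) * (real t * s / T)) =
          T - s\<^sup>2 * (D + 1) - s\<^sup>2 * (B + real t - 1) / T * D" using T' by simp
      have "s\<^sup>2 * (B + real t - 1) / T \<le> (s\<^sup>2 * B + s\<^sup>2 * T) / T"
        using D T_pos by (intro divide_right_mono) (auto simp flip: distrib_left intro!: mult_left_mono)
      also have "\<dots> \<le> 5/3 * s + s\<^sup>2" using sB T_pos by (simp add: field_simps)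
      also have "\<dots> \<le> 1/4 + 9/400" using s s2 by simp
      finally have "s\<^sup>2 * (B + real t - 1) / T * D \<le> (1/4 + 9/400) * D"
        using D by (intro mult_right_mono) auto
      moreover have "s\<^sup>2 * (D + 1) \<le> 9/400 * (D + 1)" using s s2 D by (intro mult_right_mono) auto
      ultimately show ?thesis unfolding eq using D by simp
    qed
    have "real (t + 1) * g t \<le> s * (A + (B + real t - 1) * (real t * s / T)) * g t"
      using nonneg by (intro mult_right_mono key)
    also have "\<dots> = s * (A * g t + (B + real t - 1) * (real t * s / T * g t))"
      by (simp add: algebra_simps)
    also have "\<dots> \<le> s * (A * g t + (B + real t - 1) * g (t - 1))"
      using prev B False s by (intro mult_left_mono add_left_mono) auto
    also have "\<dots> = real (t + 1) * (s * g (t + 1))"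
      using rec[of t] False by (simp del: of_nat_add)
    finally show ?thesis by (subst (asm) mult_le_cancel_left_pos) auto
  qed
qed

section \<open>The reciprocal of the cusp form as a power series with nonnegative
  coefficients\<close>

definition eis_fps :: "real fps" where
  "eis_fps = 1 + 60 * fps_X + 134 * fps_X ^ 2 + 60 * fps_X ^ 3 + fps_X ^ 4"

definition cusp_fps :: "real fps" where
  "cusp_fps = fps_X * (1 + fps_X) ^ 2 * (1 - fps_X) ^ 8"

definition geometric_fps :: "real fps" where
  "geometric_fps = Abs_fps (\<lambda>_. 1)"
definition even_geometric_fps :: "real fps" where
  "even_geometric_fps = Abs_fps (\<lambda>n. if even n then 1 else 0)"

text \<open>This is X / \<open>cusp_fps\<close>. Pairing both factors 1 + X of the denominator with
  factors 1 - X makes the nonnegativity of the coefficients visible.\<close>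

definition phi_fps :: "real fps" where
  "phi_fps = geometric_fps ^ 6 * even_geometric_fps ^ 2"

definition phi :: "real \<Rightarrow> real" where
  "phi s = (1 / (1 - s)) ^ 6 * (1 / (1 - s\<^sup>2)) ^ 2"

lemma geometric_fps: "(1 - fps_X) * geometric_fps = 1"
  by (rule fps_ext) (auto simp: geometric_fps_def algebra_simps fps_X_mult_nth)

lemma even_geometric_fps: "(1 - fps_X\<^sup>2) * even_geometric_fps = 1"
  by (rule fps_ext) (auto simp: even_geometric_fps_def algebra_simps fps_X_power_mult_nth)

lemma phi_cusp_fps: "phi_fps * cusp_fps = fps_X"
proof -
  have "(1 + fps_X) ^ 2 * (1 - fps_X) ^ 8 = ((1 - fps_X) ^ 6 * (1 - fps_X\<^sup>2) ^ 2 :: real fps)"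
    by Groebner_Basis.algebra
  then have "phi_fps * cusp_fps = fps_X * ((1 - fps_X) * geometric_fps) ^ 6 * ((1 - fps_X\<^sup>2) * even_geometric_fps) ^ 2"
    unfolding phi_fps_def cusp_fps_def by (simp add: power_mult_distrib mult_ac)
  then show ?thesis by (simp add: geometric_fps even_geometric_fps)
qed

lemma deriv_eis_fps: "fps_deriv eis_fps = 60 + 268 * fps_X + 180 * fps_X ^ 2 + 4 * fps_X ^ 3"
  unfolding eis_fps_def by (simp add: fps_deriv_power flip: numeral_fps_const)

lemma nonneg_eis_fps: "nonneg_fps eis_fps"
  unfolding eis_fps_def by (intro nonneg_fps_intros)

lemma nonneg_phi_fps: "nonneg_fps phi_fps"
proof -
  have "nonneg_fps geometric_fps" "nonneg_fps even_geometric_fps"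
    by (auto simp: nonneg_fps_def geometric_fps_def even_geometric_fps_def)
  then show ?thesis unfolding phi_fps_def by (intro nonneg_fps_intros)
qed

lemma fps_has_value_eis: "fps_has_value eis_fps s (eis s)" if "0 \<le> s"
  unfolding eis_fps_def eis_def
  by (intro fps_has_value_add fps_has_value_mult fps_has_value_power fps_has_value_basic nonneg_fps_intros that)

lemma fps_has_value_phi:
  assumes "0 \<le> s" "s < 1"
  shows "fps_has_value phi_fps s (phi s)"
proof -
  have nonneg: "nonneg_fps geometric_fps" "nonneg_fps even_geometric_fps"
    by (auto simp: nonneg_fps_def geometric_fps_def even_geometric_fps_def)
  have 1: "fps_has_value geometric_fps s (1 / (1 - s))"
    using geometric_sums[of s] assms by (simp add: fps_has_value_def geometric_fps_def)
  have "(\<lambda>n. (s ^ n + (- s) ^ n) / 2) sums ((1 / (1 - s) + 1 / (1 - (- s))) / 2)"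
    using assms by (intro sums_divide sums_add geometric_sums) auto
  moreover have "(s ^ n + (- s) ^ n) / 2 = even_geometric_fps $ n * s ^ n" for n
    by (simp add: even_geometric_fps_def)
  moreover have "(1 / (1 - s) + 1 / (1 - (- s))) / 2 = 1 / (1 - s\<^sup>2)"
  proof -
    have "1 - s\<^sup>2 = (1 - s) * (1 + s)" by Groebner_Basis.algebra
    with assms show ?thesis by (simp only: minus_minus diff_minus_eq_add) (simp add: divide_simps)
  qed
  ultimately have 2: "fps_has_value even_geometric_fps s (1 / (1 - s\<^sup>2))"
    unfolding fps_has_value_def by (simp only:)
  show ?thesis unfolding phi_fps_def phi_def
    by (intro fps_has_value_mult fps_has_value_power 1 2 nonneg nonneg_fps_intros assms)
qed

lemma phi_cusp: "0 < s \<Longrightarrow> s < 1 \<Longrightarrow> phi s * cusp s = s"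
proof -
  assume s: "0 < s" "s < 1"
  then have "s\<^sup>2 \<noteq> 1" by (auto simp: power2_eq_1_iff)
  moreover have "s * (1 + s)^2 * (1 - s)^8 = s * ((1 - s)^6 * (1 - s\<^sup>2)^2)"
    by Groebner_Basis.algebra
  moreover have "(1 - s)^6 * (1 - s\<^sup>2)^2 \<noteq> 0" using s \<open>s\<^sup>2 \<noteq> 1\<close> by simp
  ultimately show ?thesis by (simp only: phi_def cusp_def power_divide) simp
qed

lemma deriv_phi_fps: "(1 - fps_X\<^sup>2) * fps_deriv phi_fps = (6 + 10 * fps_X) * phi_fps"
proof -
  have d1: "(1 - fps_X) * fps_deriv geometric_fps = geometric_fps"
  proof -
    have "fps_deriv ((1 - fps_X) * geometric_fps) = 0" by (simp add: geometric_fps)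
    then show ?thesis by (simp add: algebra_simps)
  qed
  have d2: "(1 - fps_X\<^sup>2) * fps_deriv even_geometric_fps = 2 * fps_X * even_geometric_fps"
  proof -
    have "fps_deriv ((1 - fps_X\<^sup>2) * even_geometric_fps) = 0" by (simp add: even_geometric_fps)
    then show ?thesis by (simp add: algebra_simps fps_deriv_power numeral_fps_const)
  qed
  have "(1 - fps_X\<^sup>2) * fps_deriv phi_fps =
     6 * geometric_fps ^ 5 * (1 + fps_X) * ((1 - fps_X) * fps_deriv geometric_fps) * even_geometric_fps ^ 2
     + 2 * geometric_fps ^ 6 * even_geometric_fps * ((1 - fps_X\<^sup>2) * fps_deriv even_geometric_fps)"
    unfolding phi_fps_def by (simp add: fps_deriv_power algebra_simps power2_eq_square numeral_fps_const) 
  also have "\<dots> = (6 + 10 * fps_X) * phi_fps"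
    unfolding d1 d2 phi_fps_def by Groebner_Basis.algebra
  finally show ?thesis .
qed

lemma deriv_phi_power:
  "(1 - fps_X\<^sup>2) * fps_deriv (phi_fps ^ i * (1 + fps_X) ^ b) =
     (fps_const (6 * real i + real b) + fps_const (10 * real i - real b) * fps_X) * (phi_fps ^ i * (1 + fps_X) ^ b)"
proof -
  have d: "fps_deriv (f ^ Suc k) = of_nat (Suc k) * f ^ k * fps_deriv f" for f :: "real fps" and k
    by (simp only: fps_deriv_power diff_Suc_1 fps_of_nat mult_ac)
  have 1: "(1 - fps_X\<^sup>2) * fps_deriv (phi_fps ^ i) = of_nat i * (6 + 10 * fps_X) * phi_fps ^ i"
  proof (cases i)
    case (Suc k)
    have "(1 - fps_X\<^sup>2) * fps_deriv (phi_fps ^ i) = of_nat i * phi_fps ^ k * ((1 - fps_X\<^sup>2) * fps_deriv phi_fps)"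
      unfolding Suc d by (simp only: mult_ac)
    then show ?thesis unfolding deriv_phi_fps Suc by (simp only: power_Suc mult_ac)
  qed simp
  have 2: "(1 - fps_X\<^sup>2) * fps_deriv ((1 + fps_X) ^ b) = of_nat b * (1 - fps_X) * (1 + fps_X :: real fps) ^ b"
  proof (cases b)
    case (Suc k)
    have "1 - fps_X\<^sup>2 = (1 - fps_X) * (1 + fps_X :: real fps)" by Groebner_Basis.algebra
    then show ?thesis unfolding Suc d by (simp add: mult_ac)
  qed simp
  have c: "fps_const (6 * real i + real b) + fps_const (10 * real i - real b) * fps_X =
    of_nat i * (6 + 10 * fps_X) + of_nat b * (1 - fps_X)"
    by (simp add: fps_of_nat[symmetric] numeral_fps_const algebra_simps flip: fps_const_add fps_const_sub fps_const_mult)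
  have "(1 - fps_X\<^sup>2) * fps_deriv (phi_fps ^ i * (1 + fps_X) ^ b) =
      ((1 - fps_X\<^sup>2) * fps_deriv (phi_fps ^ i)) * (1 + fps_X) ^ b
      + phi_fps ^ i * ((1 - fps_X\<^sup>2) * fps_deriv ((1 + fps_X) ^ b))"
    by (simp add: algebra_simps)
  then show ?thesis unfolding 1 2 c by (simp add: algebra_simps)
qed

text \<open>The logarithmic derivative in \<open>deriv_phi_power\<close> is of the kind treated by
  \<open>recurrence_geometric\<close>. The factor (1 + X)^b only raises the mean, by s (1 - s) b /
  (1 - s^2), so the bound on \<open>m\<close> is stated for b = 0. For t < m the two steps below the
  mean are t + 2 \<le> m + 1.\<close>

lemma phi_power_geometric:
  assumes s: "0 < s" "s \<le> 3/20" and b: "b \<le> 6 * i"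
    and m: "(real m + 1) * (1 - s\<^sup>2) \<le> real i * (s * (6 + 10 * s))"
  shows "geometric_upto (phi_fps ^ i * (1 + fps_X) ^ b) s m"
  unfolding geometric_upto_def
proof (intro allI impI)
  fix t assume "t < m"
  define G where "G = phi_fps ^ i * (1 + fps_X) ^ b"
  define A B where "A = 6 * real i + real b" and "B = 10 * real i - real b"
  define T where "T = s * (A + B * s) / (1 - s\<^sup>2)"
  have s2: "s\<^sup>2 < 1" using s by (simp add: power_less_one_iff)
  have nonneg: "nonneg_fps G"
    unfolding G_def by (intro nonneg_fps_intros nonneg_phi_fps)
  have G: "(1 - fps_X\<^sup>2) * fps_deriv G = (fps_const A + fps_const B * fps_X) * G"
    unfolding G_def A_def B_def by (rule deriv_phi_power)
  have "fps_deriv G - fps_X ^ 2 * fps_deriv G = fps_const A * G + fps_const B * (fps_X * G)"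
    using G by (simp add: algebra_simps)
  then have coeff: "(fps_deriv G - fps_X ^ 2 * fps_deriv G) $ n = (fps_const A * G + fps_const B * (fps_X * G)) $ n" for n
    by simp
  have "real i * (s * (6 + 10 * s)) \<le> s * (A + B * s)"
  proof -
    have "s * (A + B * s) = real i * (s * (6 + 10 * s)) + s * (1 - s) * real b"
      by (simp add: A_def B_def algebra_simps)
    then show ?thesis using s by simp
  qed
  with m have "(real m + 1) * (1 - s\<^sup>2) \<le> s * (A + B * s)" by linarith
  with s2 have "real m + 1 \<le> T" by (simp add: T_def pos_le_divide_eq)
  with \<open>t < m\<close> have tT: "real t + 2 \<le> T" by linarith
  have "G $ t \<le> s * G $ (t + 1)"
  proof (rule recurrence_geometric[of "fps_nth G" A B s T t])
    show "G $ 1 = A * G $ 0"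
      using coeff[of 0] by (simp add: algebra_simps)
    show "real (t + 1) * G $ (t + 1) = A * G $ t + (B + real t - 1) * G $ (t - 1)" if "t \<ge> 1" for t
    proof -
      obtain u where u: "t = Suc u" using \<open>1 \<le> t\<close> by (cases t) auto
      have "fps_deriv G $ t - (if t < 2 then 0 else fps_deriv G $ (t - 2)) = A * G $ t + B * G $ (t - 1)"
        using coeff[of t] \<open>1 \<le> t\<close> by (simp add: fps_X_power_mult_nth split: if_splits)
      then show ?thesis
        by (cases u) (simp_all add: u algebra_simps)
    qed
    show "T * (1 - s\<^sup>2) = s * (A + B * s)" using s2 by (simp add: T_def)
    show "0 \<le> B" "B \<le> 5/3 * A" using b by (simp_all add: A_def B_def)
  qed (use nonneg s tT in \<open>auto simp: nonneg_fps_def\<close>)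
  then show "(phi_fps ^ i * (1 + fps_X) ^ b) $ t \<le> s * (phi_fps ^ i * (1 + fps_X) ^ b) $ Suc t"
    by (simp add: G_def)
qed

section \<open>Lagrange coefficients\<close>

text \<open>
  Up to the factor \<open>i\<close> this is the residue of \<open>(F / E^N) (D / E^3)^(-i) dlog (D / E^3)\<close>, integrated by
  parts, which makes the contribution of the zero word visibly negative.  The truncated
  subtraction in the exponent is only meaningful for \<open>N < 3 i\<close>.
\<close>

definition lagrange_coeff :: "nat \<Rightarrow> nat \<Rightarrow> real fps \<Rightarrow> real" where
  "lagrange_coeff N i F =
     (phi_fps ^ i * eis_fps ^ (3 * i - N - 1) *
       (fps_X * fps_deriv F * eis_fps - of_nat N * fps_X * F * fps_deriv eis_fps)) $ i"

lemma lagrange_coeff_sum: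
  "lagrange_coeff N i (\<Sum>w\<in>W. F w) = (\<Sum>w\<in>W. lagrange_coeff N i (F w))"
proof -
  have "phi_fps ^ i * eis_fps ^ (3 * i - N - 1) *
       (fps_X * fps_deriv (\<Sum>w\<in>W. F w) * eis_fps - of_nat N * fps_X * (\<Sum>w\<in>W. F w) * fps_deriv eis_fps) =
     (\<Sum>w\<in>W. phi_fps ^ i * eis_fps ^ (3 * i - N - 1) *
       (fps_X * fps_deriv (F w) * eis_fps - of_nat N * fps_X * F w * fps_deriv eis_fps))"
    by (simp add: fps_deriv_sum sum_distrib_left sum_distrib_right sum_subtractf right_diff_distrib mult_ac)
  then show ?thesis by (simp add: lagrange_coeff_def fps_sum_nth)
qed

lemma lagrange_coeff_add:
  "lagrange_coeff N i (F + G) = lagrange_coeff N i F + lagrange_coeff N i G"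
  by (simp add: lagrange_coeff_def algebra_simps)

lemma lagrange_coeff_smult:
  "lagrange_coeff N i (fps_const c * F) = c * lagrange_coeff N i F"
proof -
  have "phi_fps ^ i * eis_fps ^ (3 * i - N - 1) *
       (fps_X * fps_deriv (fps_const c * F) * eis_fps - of_nat N * fps_X * (fps_const c * F) * fps_deriv eis_fps)
     = fps_const c * (phi_fps ^ i * eis_fps ^ (3 * i - N - 1) *
       (fps_X * fps_deriv F * eis_fps - of_nat N * fps_X * F * fps_deriv eis_fps))"
    by (simp add: algebra_simps)
  then show ?thesis unfolding lagrange_coeff_def by (simp only: fps_mult_left_const_nth)
qed

lemma fps_deriv_power_Suc: "fps_deriv (f ^ Suc k) = of_nat (Suc k) * f ^ k * fps_deriv f"
  for f :: "real fps"
  by (simp only: fps_deriv_power diff_Suc_1 fps_of_nat mult_ac)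

text \<open>With l = i - j and Y = (phi E^3)^l the series, multiplied by \<open>l\<close>, becomes j
  X^j (l Y - X Y'), and the coefficient of X^l in l Y - X Y' is zero. For j = 0 the bracket in
  \<open>lagrange_coeff\<close> vanishes by itself.\<close>

lemma lagrange_coeff_invariant:
  assumes "3 * j \<le> N" "j < i" "N < 3 * i"
  shows "lagrange_coeff N i (eis_fps ^ (N - 3 * j) * cusp_fps ^ j) = 0"
proof -
  define l where "l = i - j"
  have il: "i = l + j" "0 < l" using assms by (auto simp: l_def)
  define E D P where "E = eis_fps" and "D = cusp_fps" and "P = phi_fps"
  define Y where "Y = P ^ l * E ^ (3 * l)"
  define a e where "a = 3 * i - N - 1" and "e = N - 3 * j"
  have PD: "P * D = fps_X" unfolding P_def D_def by (rule phi_cusp_fps)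
  then have PD': "P * fps_deriv D = 1 - fps_deriv P * D"
    by (metis add_diff_cancel_right' fps_deriv_fps_X fps_deriv_mult)
  obtain l' where l': "l = Suc l'" using il by (cases l) auto
  have ae: "a + e = 3 * l' + 2" "N = e + 3 * j"
    using assms il l' by (auto simp: a_def e_def)
  show ?thesis
  proof (cases j)
    case 0
    have "lagrange_coeff N i (E ^ N) = 0"
      by (cases N) (simp_all add: lagrange_coeff_def fps_deriv_power_Suc E_def mult_ac del: of_nat_Suc power_Suc,
          simp add: mult_ac)
    with 0 show ?thesis by (simp add: E_def)
  next
    case (Suc j')
    have F': "E * fps_deriv (E ^ e * D ^ j) = of_nat e * E ^ e * fps_deriv E * D ^ j + of_nat j * E ^ Suc e * D ^ j' * fps_deriv D"
    proof -
      have "E * fps_deriv (E ^ e) = of_nat e * E ^ e * fps_deriv E"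
      proof (cases e)
        case (Suc e')
        show ?thesis unfolding Suc fps_deriv_power_Suc by (simp add: mult_ac)
      qed simp
      moreover have "fps_deriv (D ^ j) = of_nat j * D ^ j' * fps_deriv D"
        unfolding Suc by (rule fps_deriv_power_Suc)
      moreover have "E * fps_deriv (E ^ e * D ^ j) = (E * fps_deriv (E ^ e)) * D ^ j + E * E ^ e * fps_deriv (D ^ j)"
        by (simp add: algebra_simps)
      ultimately show ?thesis by (simp only: power_Suc mult_ac)
    qed
    have "fps_X * fps_deriv (E ^ e * D ^ j) * E - of_nat N * fps_X * (E ^ e * D ^ j) * fps_deriv E
      = fps_X * (E * fps_deriv (E ^ e * D ^ j)) - of_nat N * fps_X * (E ^ e * D ^ j) * fps_deriv E"
      by (simp only: mult_ac)
    also have "\<dots> = of_nat j * fps_X * E ^ e * D ^ j' * (E * fps_deriv D - 3 * fps_deriv E * D)"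
      unfolding F' unfolding ae(2) Suc by (simp add: algebra_simps)
    also have "P ^ i * E ^ a * \<dots> = of_nat j * fps_X * E ^ (a + e) * P ^ l * (P * D) ^ j' * (E * (P * fps_deriv D) - 3 * fps_deriv E * (P * D))"
      unfolding il(1) Suc by (simp add: power_add power_mult_distrib algebra_simps)
    also have "\<dots> = of_nat j * fps_X ^ j * (P ^ l * E ^ (3 * l' + 2) * (E - E * fps_deriv P * D - 3 * fps_deriv E * fps_X))"
      unfolding PD PD' ae(1) Suc by (simp add: algebra_simps)
    also have "P ^ l * E ^ (3 * l' + 2) * (E - E * fps_deriv P * D - 3 * fps_deriv E * fps_X)
      = Y - (P * D) * P ^ l' * fps_deriv P * E ^ (3 * l' + 3) - 3 * fps_X * P ^ l * E ^ (3 * l' + 2) * fps_deriv E"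
      unfolding Y_def l' by (simp add: algebra_simps eval_nat_numeral)
    finally have eq: "P ^ i * E ^ a * (fps_X * fps_deriv (E ^ e * D ^ j) * E - of_nat N * fps_X * (E ^ e * D ^ j) * fps_deriv E)
      = of_nat j * fps_X ^ j * (Y - fps_X * P ^ l' * fps_deriv P * E ^ (3 * l' + 3) - 3 * fps_X * P ^ l * E ^ (3 * l' + 2) * fps_deriv E)"
      unfolding PD .
    have "fps_deriv Y = of_nat l * (P ^ l' * fps_deriv P * E ^ (3 * l' + 3)) + of_nat l * (3 * P ^ l * E ^ (3 * l' + 2) * fps_deriv E)"
    proof -
      have 3: "3 * l = Suc (3 * l' + 2)" using l' by simp
      have d1: "fps_deriv (E ^ (3 * l)) = of_nat (3 * l) * E ^ (3 * l' + 2) * fps_deriv E"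
        unfolding 3 by (rule fps_deriv_power_Suc)
      have d2: "fps_deriv (P ^ l) = of_nat l * P ^ l' * fps_deriv P"
        unfolding l' by (rule fps_deriv_power_Suc)
      have "3 * l = 3 * l' + 3" using l' by simp
      then have E3: "E ^ (3 * l) = E ^ (3 * l' + 3)" by (simp only:)
      have "fps_deriv Y = P ^ l * fps_deriv (E ^ (3 * l)) + fps_deriv (P ^ l) * E ^ (3 * l)"
        unfolding Y_def by (rule fps_deriv_mult)
      then show ?thesis unfolding d1 d2 unfolding E3 of_nat_mult of_nat_numeral by (simp only: mult_ac add_ac)
    qed
    then have Y': "of_nat l * (Y - fps_X * P ^ l' * fps_deriv P * E ^ (3 * l' + 3) - 3 * fps_X * P ^ l * E ^ (3 * l' + 2) * fps_deriv E)
        = of_nat l * Y - fps_X * fps_deriv Y"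
      by (simp add: algebra_simps)
    have "real l * (P ^ i * E ^ a * (fps_X * fps_deriv (E ^ e * D ^ j) * E - of_nat N * fps_X * (E ^ e * D ^ j) * fps_deriv E)) $ i
       = (of_nat j * (fps_X ^ j * (of_nat l * (Y - fps_X * P ^ l' * fps_deriv P * E ^ (3 * l' + 3) - 3 * fps_X * P ^ l * E ^ (3 * l' + 2) * fps_deriv E)))) $ i"
      unfolding eq by (simp only: fps_of_nat[symmetric] fps_mult_left_const_nth[symmetric] mult_ac)
    also have "\<dots> = (of_nat j * (fps_X ^ j * (of_nat l * Y - fps_X * fps_deriv Y))) $ i"
      by (simp only: Y')
    also have "\<dots> = 0"
      using il l' by (simp add: fps_of_nat[symmetric] fps_X_power_mult_nth)
    finally show ?thesis using il by (simp add: lagrange_coeff_def E_def D_def P_def a_def e_def)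
  qed
qed

lemma lagrange_coeff_one:
  assumes "0 < i"
  shows "lagrange_coeff N i 1 =
    - (real N * (phi_fps ^ i * eis_fps ^ (3 * i - N - 1) * fps_deriv eis_fps) $ (i - 1))"
proof -
  have "phi_fps ^ i * eis_fps ^ (3 * i - N - 1) *
       (fps_X * fps_deriv 1 * eis_fps - of_nat N * fps_X * 1 * fps_deriv eis_fps)
     = fps_const (- real N) * (fps_X * (phi_fps ^ i * eis_fps ^ (3 * i - N - 1) * fps_deriv eis_fps))"
    by (simp add: fps_of_nat[symmetric] mult_ac flip: fps_const_neg)
  then show ?thesis using assms by (simp add: lagrange_coeff_def)
qed

section \<open>Contributions of the nonzero words\<close>

definition word_fps :: "nat \<Rightarrow> nat \<Rightarrow> real fps" where
  "word_fps k b = fps_X ^ k * (fps_const (1/2) * (1 + fps_X)) ^ b"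

text \<open>\<open>word_fps k b\<close> is the term of F that belongs to a word of weight
  \<open>8 k\<close> with \<open>4 b\<close> odd coordinates. Here its factor X^k is removed and the
  common factors of the Lagrange coefficient are included, so the coefficient to watch is the one at
  \<open>i - k\<close>.\<close>

definition shell_fps :: "nat \<Rightarrow> nat \<Rightarrow> nat \<Rightarrow> real fps" where
  "shell_fps N i b = phi_fps ^ i * eis_fps ^ (3 * i - N - 1) * (fps_const (1/2) * (1 + fps_X)) ^ b"

lemma nonneg_shell_fps: "nonneg_fps (shell_fps N i b)"
  unfolding shell_fps_def by (intro nonneg_fps_intros nonneg_phi_fps nonneg_eis_fps) simp

lemma X_deriv_word_fps:
  "fps_X * fps_deriv (word_fps k b) =
     of_nat k * word_fps k b + of_nat b * fps_X ^ Suc k * fps_const (1/2) * (fps_const (1/2) * (1 + fps_X)) ^ (b - 1)"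
proof -
  have 1: "fps_X * fps_deriv (fps_X ^ k) = of_nat k * (fps_X ^ k :: real fps)"
  proof (cases k)
    case (Suc k')
    show ?thesis unfolding Suc fps_deriv_power_Suc by (simp add: mult_ac)
  qed simp
  have 2: "fps_deriv ((fps_const (1/2) * (1 + fps_X)) ^ b) = of_nat b * fps_const (1/2) * (fps_const (1/2) * (1 + fps_X :: real fps)) ^ (b - 1)"
  proof (cases b)
    case (Suc b')
    show ?thesis unfolding Suc fps_deriv_power_Suc by (simp add: mult_ac)
  qed simp
  have "fps_X * fps_deriv (word_fps k b) = (fps_X * fps_deriv (fps_X ^ k)) * (fps_const (1/2) * (1 + fps_X)) ^ b
     + fps_X ^ Suc k * fps_deriv ((fps_const (1/2) * (1 + fps_X)) ^ b)"
    unfolding word_fps_def by (simp only: fps_deriv_mult power_Suc) (simp only: algebra_simps)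
  then show ?thesis unfolding 1 2 word_fps_def by (simp only: mult_ac)
qed

lemma fps_nth_mono_mult:
  assumes "nonneg_fps F" "nonneg_fps (G - H)"
  shows "(F * H) $ n \<le> (F * G) $ n"
proof -
  have "nonneg_fps (F * (G - H))" using assms by (rule nonneg_fps_mult)
  then have "0 \<le> (F * (G - H)) $ n" by (rule nonneg_fps_nth)
  then show ?thesis by (simp add: right_diff_distrib)
qed

lemma lagrange_coeff_word_gt:
  assumes "i < k"
  shows "lagrange_coeff N i (word_fps k b) = 0"
proof -
  have "fps_X * fps_deriv (word_fps k b) * eis_fps - of_nat N * fps_X * word_fps k b * fps_deriv eis_fps
    = fps_X ^ k * ((of_nat k * (fps_const (1/2) * (1 + fps_X)) ^ b
         + of_nat b * fps_X * fps_const (1/2) * (fps_const (1/2) * (1 + fps_X)) ^ (b - 1)) * eis_fps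
       - of_nat N * fps_X * (fps_const (1/2) * (1 + fps_X)) ^ b * fps_deriv eis_fps)"
    unfolding X_deriv_word_fps unfolding word_fps_def power_Suc by (simp only: algebra_simps)
  then show ?thesis using assms
    by (simp add: lagrange_coeff_def mult.left_commute[of _ "fps_X ^ k"] fps_X_power_mult_nth)
qed

text \<open>The subtracted term is dropped. By b \<le> 2 k the derivative X F' is coefficientwise at
  most k (1 + 2 X) F, and (1 + 2 s) \<open>eis s\<close> is at most 16/9 for s \<le> 1/1000.\<close>

lemma lagrange_coeff_word_le:
  assumes "k \<le> i" "b \<le> 2 * k" and g: "geometric_upto (shell_fps N i b) s (i - k)"
    and s: "0 < s" "s \<le> 1/1000"
  shows "lagrange_coeff N i (word_fps k b) \<le> 2 * real k * shell_fps N i b $ (i - k)"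
proof -
  define h where "h = fps_const (1/2) * (1 + fps_X :: real fps)"
  define Q where "Q = phi_fps ^ i * eis_fps ^ (3 * i - N - 1)"
  have nonneg: "nonneg_fps h" "nonneg_fps Q"
    unfolding h_def Q_def by (intro nonneg_fps_intros nonneg_phi_fps nonneg_eis_fps; simp)+
  have "lagrange_coeff N i (word_fps k b) \<le> (Q * (fps_X * fps_deriv (word_fps k b) * eis_fps)) $ i"
    unfolding lagrange_coeff_def Q_def[symmetric]
    by (rule fps_nth_mono_mult) (use nonneg nonneg_eis_fps in \<open>auto intro!: nonneg_fps_intros simp: word_fps_def simp flip: h_def\<close>)
  also have "\<dots> \<le> (Q * (of_nat k * fps_X ^ k * h ^ b * (1 + 2 * fps_X) * eis_fps)) $ i"
  proof (rule fps_nth_mono_mult[OF nonneg(2)])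
    have "nonneg_fps (of_nat (2 * k) * h ^ b - of_nat b * fps_const (1/2) * h ^ (b - 1))"
    proof (cases b)
      case (Suc b')
      have hb: "h ^ b = fps_const (1/2) * (1 + fps_X) * h ^ b'"
        by (simp add: Suc h_def)
      have "of_nat (2 * k) * h ^ b - of_nat b * fps_const (1/2) * h ^ (b - 1)
        = fps_const (1/2) * h ^ b' * (of_nat (2 * k) - of_nat b + of_nat (2 * k) * fps_X)"
        unfolding hb unfolding Suc diff_Suc_1 by (simp only: algebra_simps mult_1_left)
      also have "of_nat (2 * k) - of_nat b = (of_nat (2 * k - b) :: real fps)"
        using assms(2) by (rule of_nat_diff[symmetric])
      finally show ?thesis using nonneg by (simp only:) (intro nonneg_fps_intros; simp)
    qed (use nonneg in \<open>auto intro!: nonneg_fps_intros\<close>)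
    then have "nonneg_fps (fps_X ^ Suc k * eis_fps * (of_nat (2 * k) * h ^ b - of_nat b * fps_const (1/2) * h ^ (b - 1)))"
      by (intro nonneg_fps_mult nonneg_eis_fps nonneg_fps_power) simp_all
    also have "fps_X ^ Suc k * eis_fps * (of_nat (2 * k) * h ^ b - of_nat b * fps_const (1/2) * h ^ (b - 1))
      = of_nat k * fps_X ^ k * h ^ b * (1 + 2 * fps_X) * eis_fps - fps_X * fps_deriv (word_fps k b) * eis_fps"
      unfolding X_deriv_word_fps unfolding word_fps_def h_def[symmetric] power_Suc of_nat_mult of_nat_numeral
      by (simp only: algebra_simps mult_1_left)
    finally show "nonneg_fps \<dots>" .
  qed
  also have "\<dots> = real k * (fps_X ^ k * (((1 + 2 * fps_X) * eis_fps) * shell_fps N i b)) $ i"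
    unfolding fps_mult_left_const_nth[symmetric] fps_of_nat shell_fps_def Q_def h_def[symmetric] by (simp only: mult_ac)
  also have "\<dots> = real k * (((1 + 2 * fps_X) * eis_fps) * shell_fps N i b) $ (i - k)"
    using assms by (simp add: fps_X_power_mult_nth)
  also have "\<dots> \<le> real k * (((1 + 2 * s) * eis s) * shell_fps N i b $ (i - k))"
    by (intro mult_left_mono geometric_upto_mult_nth_le[OF g] nonneg_shell_fps nonneg_fps_intros nonneg_eis_fps
          fps_has_value_add fps_has_value_mult fps_has_value_basic fps_has_value_eis) (use s in auto)
  also have "\<dots> \<le> real k * (2 * shell_fps N i b $ (i - k))"
  proof -
    have "s ^ j \<le> s" if "0 < j" for j using power_decreasing[of 1 j s] s that by simp
    from this[of 2] this[of 3] this[of 4] have "eis s \<le> 4/3" unfolding eis_def using s by simp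
    moreover have "1 + 2 * s \<le> 4/3" using s by simp
    moreover have "0 \<le> eis s" unfolding eis_def using s by simp
    ultimately have "(1 + 2 * s) * eis s \<le> 4/3 * (4/3)" using s by (intro mult_mono) auto
    then have "(1 + 2 * s) * eis s \<le> 2" by simp
    then show ?thesis using nonneg_fps_nth[OF nonneg_shell_fps] by (intro mult_left_mono mult_right_mono) auto
  qed
  finally show ?thesis by simp
qed

text \<open>Here the subtracted term matters: at s \<le> 1/1000 the series X E' is at most 1/8, and
  N \<le> 4 k, so it destroys at most half of the main term.\<close>

lemma lagrange_coeff_word_ge:
  assumes "k \<le> i" "real N \<le> 4 * real k" and g: "geometric_upto (shell_fps N i b) s (i - k)"
    and s: "0 < s" "s \<le> 1/1000"
  shows "real k / 2 * shell_fps N i b $ (i - k) \<le> lagrange_coeff N i (word_fps k b)"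
proof -
  define h where "h = fps_const (1/2) * (1 + fps_X :: real fps)"
  define Q where "Q = phi_fps ^ i * eis_fps ^ (3 * i - N - 1)"
  have nonneg: "nonneg_fps h" "nonneg_fps Q"
    unfolding h_def Q_def by (intro nonneg_fps_intros nonneg_phi_fps nonneg_eis_fps; simp)+
  have eisv: "fps_has_value (fps_X * fps_deriv eis_fps) s (60 * s + 268 * s^2 + 180 * s^3 + 4 * s^4)"
  proof -
    have "fps_X * fps_deriv eis_fps = 60 * fps_X + 268 * fps_X ^ 2 + 180 * fps_X ^ 3 + 4 * fps_X ^ 4"
      unfolding deriv_eis_fps by Groebner_Basis.algebra
    then show ?thesis
      by (simp only:) (intro fps_has_value_add fps_has_value_mult fps_has_value_power fps_has_value_basic nonneg_fps_intros less_imp_le s)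
  qed
  have "real k * shell_fps N i b $ (i - k) - real N * ((fps_X * fps_deriv eis_fps) * shell_fps N i b) $ (i - k)
     = (fps_X ^ k * (of_nat k * shell_fps N i b - of_nat N * ((fps_X * fps_deriv eis_fps) * shell_fps N i b))) $ i"
    using assms(1) by (simp add: fps_X_power_mult_nth fps_of_nat[symmetric])
  also have "\<dots> = (Q * (fps_X ^ k * h ^ b * (of_nat k - of_nat N * (fps_X * fps_deriv eis_fps)))) $ i"
    unfolding shell_fps_def Q_def h_def[symmetric] by (simp only: algebra_simps)
  also have "\<dots> \<le> lagrange_coeff N i (word_fps k b)"
    unfolding lagrange_coeff_def Q_def[symmetric]
  proof (rule fps_nth_mono_mult[OF nonneg(2)])
    have "nonneg_fps (fps_X ^ k * h ^ b * of_nat k * (eis_fps - 1) + of_nat b * fps_X ^ Suc k * fps_const (1/2) * h ^ (b - 1) * eis_fps)"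
      by (intro nonneg_fps_intros nonneg nonneg_eis_fps) (auto simp: eis_fps_def intro!: nonneg_fps_intros)
    also have "fps_X ^ k * h ^ b * of_nat k * (eis_fps - 1) + of_nat b * fps_X ^ Suc k * fps_const (1/2) * h ^ (b - 1) * eis_fps
      = fps_X * fps_deriv (word_fps k b) * eis_fps - of_nat N * fps_X * word_fps k b * fps_deriv eis_fps
        - fps_X ^ k * h ^ b * (of_nat k - of_nat N * (fps_X * fps_deriv eis_fps))"
      unfolding X_deriv_word_fps unfolding word_fps_def h_def[symmetric] by (simp only: algebra_simps mult_1_left)
    finally show "nonneg_fps \<dots>" .
  qed
  finally have "real k * shell_fps N i b $ (i - k) - real N * ((fps_X * fps_deriv eis_fps) * shell_fps N i b) $ (i - k)
     \<le> lagrange_coeff N i (word_fps k b)" .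
  moreover have "((fps_X * fps_deriv eis_fps) * shell_fps N i b) $ (i - k) \<le> (60 * s + 268 * s^2 + 180 * s^3 + 4 * s^4) * shell_fps N i b $ (i - k)"
    by (intro geometric_upto_mult_nth_le[OF g] nonneg_shell_fps nonneg_fps_intros nonneg_eis_fps eisv) (use s in auto)
  moreover have "real N * ((60 * s + 268 * s^2 + 180 * s^3 + 4 * s^4) * shell_fps N i b $ (i - k)) \<le> (4 * real k) * (1/8 * shell_fps N i b $ (i - k))"
  proof (intro mult_mono)
    have "s ^ j \<le> s / 1000" if "1 < j" for j
    proof -
      have "s ^ j \<le> s ^ 2" using s \<open>1 < j\<close> by (intro power_decreasing) auto
      also have "\<dots> = s * s" by (rule power2_eq_square)
      also have "\<dots> \<le> s * (1 / 1000)" using s by (intro mult_left_mono) auto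
      finally show ?thesis by simp
    qed
    from this[of 2] this[of 3] this[of 4] show "60 * s + 268 * s^2 + 180 * s^3 + 4 * s^4 \<le> 1/8"
      using s by simp
  qed (use assms nonneg_fps_nth[OF nonneg_shell_fps] s in auto)
  ultimately have "real k * shell_fps N i b $ (i - k) - 4 * real k * (1/8 * shell_fps N i b $ (i - k)) \<le> lagrange_coeff N i (word_fps k b)"
    using mult_left_mono[of "((fps_X * fps_deriv eis_fps) * shell_fps N i b) $ (i - k)"
        "(60 * s + 268 * s^2 + 180 * s^3 + 4 * s^4) * shell_fps N i b $ (i - k)" "real N"]
    by linarith
  then show ?thesis by simp
qed

lemma eis_ge_1: "0 \<le> s \<Longrightarrow> 1 \<le> eis s"
  by (simp add: eis_def)

lemma phi_ge_1:
  assumes "0 \<le> s" "s < 1"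
  shows "1 \<le> phi s"
proof -
  have "s\<^sup>2 < 1" using assms by (simp add: power_less_one_iff)
  then have "1 \<le> 1 / (1 - s)" "1 \<le> 1 / (1 - s\<^sup>2)" using assms by (simp_all add: le_divide_eq)
  then have "1 * 1 \<le> phi s"
    unfolding phi_def by (intro mult_mono one_le_power) auto
  then show ?thesis by simp
qed

lemma eis_phi_le:
  assumes "0 \<le> s" "s \<le> 1/500"
  shows "eis s ^ 3 * phi s \<le> 3/2"
proof -
  have s2: "s\<^sup>2 \<le> s" using assms by (simp add: power2_eq_square mult_left_le)
  have p: "s ^ j \<le> s * (1/500)" if "2 \<le> j" for j
  proof -
    have "s ^ j \<le> s ^ 2" using assms that by (intro power_decreasing) auto
    also have "\<dots> = s * s" by (rule power2_eq_square)
    also have "\<dots> \<le> s * (1/500)" using assms by (intro mult_left_mono) auto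
    finally show ?thesis .
  qed
  have "eis s \<le> 1123/1000"
    unfolding eis_def using p[of 2] p[of 3] p[of 4] assms by simp
  then have "eis s ^ 3 \<le> (1123/1000) ^ 3"
    using eis_ge_1[OF assms(1)] by (intro power_mono) auto
  moreover have "phi s \<le> (500/499) ^ 6 * (500/499) ^ 2"
    unfolding phi_def using assms s2 by (intro mult_mono power_mono) (auto simp: field_simps)
  ultimately have "eis s ^ 3 * phi s \<le> (1123/1000) ^ 3 * ((500/499) ^ 6 * (500/499) ^ 2)"
    using phi_ge_1[of s] assms by (intro mult_mono) auto
  also have "\<dots> \<le> 3/2" by (simp add: power_divide)
  finally show ?thesis .
qed

lemma shell_fps_add:
  assumes "N < 3 * i"
  shows "shell_fps N (i + L) b = (eis_fps ^ 3 * phi_fps) ^ L * shell_fps N i b"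
proof -
  have "3 * (i + L) - N - 1 = 3 * L + (3 * i - N - 1)" using assms by simp
  then show ?thesis
    unfolding shell_fps_def by (simp only: power_add power_mult power_mult_distrib) (simp only: mult_ac)
qed

lemma shell_fps_geometric:
  assumes "0 < s" "s \<le> 3/20" "b \<le> 6 * i" "(real m + 1) * (1 - s\<^sup>2) \<le> real i * (s * (6 + 10 * s))"
  shows "geometric_upto (shell_fps N i b) s m"
proof -
  have "geometric_upto ((eis_fps ^ (3 * i - N - 1) * fps_const (1/2) ^ b) * (phi_fps ^ i * (1 + fps_X) ^ b)) s m"
    using assms
    by (intro geometric_upto_mult phi_power_geometric nonneg_fps_intros nonneg_phi_fps nonneg_eis_fps) auto
  moreover have "shell_fps N i b = (eis_fps ^ (3 * i - N - 1) * fps_const (1/2) ^ b) * (phi_fps ^ i * (1 + fps_X) ^ b)"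
    unfolding shell_fps_def by (simp only: power_mult_distrib mult_ac)
  ultimately show ?thesis by simp
qed

text \<open>The tail bound is used with r = 2 s, where E^3 phi is at most 3/2: the tail is at most
  (3/4)^L \<le> 27/64 for L \<ge> 3, less than half of a value that is at least 1.\<close>

lemma eis_phi_partial_sum_ge:
  assumes "0 < s" "s \<le> 1/1000" "3 \<le> L"
  shows "(eis s ^ 3 * phi s) ^ L / 2 \<le> (\<Sum>l\<le>L. ((eis_fps ^ 3 * phi_fps) ^ L) $ l * s ^ l)"
proof -
  have nonneg: "nonneg_fps (eis_fps ^ 3 * phi_fps)" "nonneg_fps ((eis_fps ^ 3 * phi_fps) ^ L)"
    by (intro nonneg_fps_intros nonneg_eis_fps nonneg_phi_fps)+
  have val: "fps_has_value ((eis_fps ^ 3 * phi_fps) ^ L) r ((eis r ^ 3 * phi r) ^ L)" if "0 \<le> r" "r < 1" for r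
    using that by (intro fps_has_value_power fps_has_value_mult nonneg_fps_intros nonneg nonneg_eis_fps nonneg_phi_fps
        fps_has_value_eis fps_has_value_phi)
  have ge1: "1 \<le> eis r ^ 3 * phi r" if "0 \<le> r" "r < 1" for r
    using mult_mono[of 1 "eis r ^ 3" 1 "phi r"] eis_ge_1[of r] phi_ge_1[of r] that by (simp add: one_le_power)
  have "(s / (2 * s)) ^ L * (eis (2 * s) ^ 3 * phi (2 * s)) ^ L = (1/2 * (eis (2 * s) ^ 3 * phi (2 * s))) ^ L"
    using assms by (simp add: power_mult_distrib power_divide)
  also have "\<dots> \<le> (1/2 * (3/2)) ^ L"
    using eis_phi_le[of "2 * s"] ge1[of "2 * s"] assms by (intro power_mono mult_left_mono) auto
  also have "\<dots> \<le> (3/4) ^ 3" using assms(3) by (intro order_trans[OF power_decreasing[of 3 L]]) auto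
  also have "\<dots> \<le> (1/2 :: real)" by (simp add: power_divide)
  also have "1/2 \<le> (eis s ^ 3 * phi s) ^ L / 2"
    using ge1[of s] assms by (simp add: one_le_power)
  finally have "(eis s ^ 3 * phi s) ^ L / 2 \<le> (eis s ^ 3 * phi s) ^ L - (s / (2 * s)) ^ L * (eis (2 * s) ^ 3 * phi (2 * s)) ^ L"
    by simp
  also have "\<dots> \<le> (\<Sum>l<L. ((eis_fps ^ 3 * phi_fps) ^ L) $ l * s ^ l)"
    using assms by (intro fps_partial_sum_ge nonneg val) auto
  also have "\<dots> \<le> (\<Sum>l\<le>L. ((eis_fps ^ 3 * phi_fps) ^ L) $ l * s ^ l)"
    using nonneg(2) assms by (intro sum_mono2) (auto simp: nonneg_fps_def)
  finally show ?thesis .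
qed

text \<open>For k \<le> i the index shift multiplies the shell by (E^3 phi)^L and moves the
  coefficient by \<open>L\<close> places. The factor 1/8 combines the constants 2 and 1/2 of the
  bounds for a word with the 1/2 of the partial sum. For larger \<open>k\<close> the contribution at
  \<open>i\<close> is zero, and the one at \<open>i + L\<close> is zero or bounded below by
  0.\<close>

lemma lagrange_coeff_word_compare:
  assumes s: "0 < s" "s \<le> 1/1000" and L: "3 \<le> L" and N: "N < 3 * i"
    and b: "b \<le> 2 * k" "b \<le> 6 * i" and k: "real N \<le> 4 * real k"
    and m: "(real (i + L - k) + 1) * (1 - s\<^sup>2) \<le> real i * (s * (6 + 10 * s))"
  shows "1/8 * ((eis s ^ 3 * phi s) / s) ^ L * lagrange_coeff N i (word_fps k b) \<le> lagrange_coeff N (i + L) (word_fps k b)"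
proof -
  have nonneg: "nonneg_fps ((eis_fps ^ 3 * phi_fps) ^ L)"
    by (intro nonneg_fps_intros nonneg_eis_fps nonneg_phi_fps)
  have g: "geometric_upto (shell_fps N i b) s (i + L - k)"
    using s b(2) m by (intro shell_fps_geometric) auto
  then have g': "geometric_upto (shell_fps N (i + L) b) s (i + L - k)"
    unfolding shell_fps_add[OF N] using s by (intro geometric_upto_mult nonneg nonneg_shell_fps) auto
  have pos: "0 < eis s ^ 3 * phi s"
    using eis_ge_1[of s] phi_ge_1[of s] s by (intro mult_pos_pos zero_less_power) auto
  consider "i + L < k" | "i < k" "k \<le> i + L" | "k \<le> i" by linarith
  then show ?thesis
  proof cases
    case 1
    then show ?thesis by (simp add: lagrange_coeff_word_gt)
  next
    case 2
    have "0 \<le> real k / 2 * shell_fps N (i + L) b $ (i + L - k)"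
      using nonneg_fps_nth[OF nonneg_shell_fps] by simp
    also have "\<dots> \<le> lagrange_coeff N (i + L) (word_fps k b)"
      using 2 k s g' by (intro lagrange_coeff_word_ge) auto
    finally show ?thesis using 2 by (simp add: lagrange_coeff_word_gt)
  next
    case 3
    define h where "h = shell_fps N i b $ (i - k)"
    have h: "0 \<le> h" unfolding h_def by (rule nonneg_fps_nth[OF nonneg_shell_fps])
    have gi: "geometric_upto (shell_fps N i b) s (i - k)"
      using g 3 by (auto simp: geometric_upto_def)
    have "1/8 * ((eis s ^ 3 * phi s) / s) ^ L * lagrange_coeff N i (word_fps k b)
        \<le> 1/8 * ((eis s ^ 3 * phi s) / s) ^ L * (2 * real k * h)"
      unfolding h_def using 3 b s pos by (intro mult_left_mono lagrange_coeff_word_le[OF _ _ gi]) auto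
    also have "\<dots> = real k / 2 * (((eis s ^ 3 * phi s) ^ L / 2) / s ^ L * h)"
      by (simp add: power_divide)
    also have "\<dots> \<le> real k / 2 * ((\<Sum>l\<le>L. ((eis_fps ^ 3 * phi_fps) ^ L) $ l * s ^ l) / s ^ L * h)"
      using h s L by (intro mult_left_mono mult_right_mono divide_right_mono eis_phi_partial_sum_ge) auto
    also have "\<dots> \<le> real k / 2 * (((eis_fps ^ 3 * phi_fps) ^ L * shell_fps N i b) $ (i - k + L))"
      unfolding h_def using 3 s
      by (intro mult_left_mono geometric_upto_mult_nth_ge[OF g] nonneg nonneg_shell_fps) auto
    also have "\<dots> = real k / 2 * (shell_fps N (i + L) b $ (i + L - k))"
      using 3 by (simp add: shell_fps_add[OF N])
    also have "\<dots> \<le> lagrange_coeff N (i + L) (word_fps k b)"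
      using 3 k s g' by (intro lagrange_coeff_word_ge) auto
    finally show ?thesis .
  qed
qed

section \<open>The contribution of the zero word, up to the factor -N\<close>

definition gap_coeff :: "nat \<Rightarrow> nat \<Rightarrow> real" where
  "gap_coeff N i = (phi_fps ^ i * eis_fps ^ (3 * i - N - 1) * fps_deriv eis_fps) $ (i - 1)"

lemma sum_lagrange_coeff_words:
  assumes eq: "1 + (\<Sum>w\<in>W. word_fps (k w) (b w)) = (\<Sum>j\<le>N div 3. fps_const (c j) * (eis_fps ^ (N - 3 * j) * cusp_fps ^ j))"
    and N: "N < 3 * i"
  shows "(\<Sum>w\<in>W. lagrange_coeff N i (word_fps (k w) (b w))) = real N * gap_coeff N i"
proof -
  have "lagrange_coeff N i (1 + (\<Sum>w\<in>W. word_fps (k w) (b w))) = 0"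
    unfolding eq lagrange_coeff_sum lagrange_coeff_smult
    using N by (intro sum.neutral ballI) (auto intro!: lagrange_coeff_invariant)
  then show ?thesis
    using lagrange_coeff_one[of i N] N
    by (simp add: lagrange_coeff_add lagrange_coeff_sum gap_coeff_def)
qed

text \<open>The contributions of the words add up to \<open>N * gap_coeff N i\<close> at every index
  above N/3, so the comparison of single words carries over whatever their number is.\<close>

lemma gap_coeff_compare:
  assumes eq: "1 + (\<Sum>w\<in>W. word_fps (k w) (b w)) = (\<Sum>j\<le>N div 3. fps_const (c j) * (eis_fps ^ (N - 3 * j) * cusp_fps ^ j))"
    and s: "0 < s" "s \<le> 1/1000" and L: "3 \<le> L" and N: "0 < N" "N < 3 * i"
    and b: "\<And>w. w \<in> W \<Longrightarrow> b w \<le> 2 * k w \<and> b w \<le> 6 * i"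
    and k: "\<And>w. w \<in> W \<Longrightarrow> real N \<le> 4 * real (k w)"
    and m: "\<And>w. w \<in> W \<Longrightarrow> (real (i + L - k w) + 1) * (1 - s\<^sup>2) \<le> real i * (s * (6 + 10 * s))"
  shows "1/8 * ((eis s ^ 3 * phi s) / s) ^ L * gap_coeff N i \<le> gap_coeff N (i + L)"
proof -
  have "1/8 * ((eis s ^ 3 * phi s) / s) ^ L * (real N * gap_coeff N i) \<le> real N * gap_coeff N (i + L)"
    unfolding sum_lagrange_coeff_words[OF eq N(2), symmetric]
      sum_lagrange_coeff_words[OF eq trans_less_add1[OF N(2), of "3 * L", folded add_mult_distrib2], symmetric]
      sum_distrib_left
    using b k m s L N by (intro sum_mono lagrange_coeff_word_compare) auto
  then have "real N * (1/8 * ((eis s ^ 3 * phi s) / s) ^ L * gap_coeff N i) \<le> real N * gap_coeff N (i + L)"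
    by (simp only: mult_ac)
  then show ?thesis using N by (simp only: mult_le_cancel_left_pos of_nat_0_less_iff)
qed

text \<open>A coefficient bound by the value at \<open>s\<close>. As \<open>i\<close> is the least
  index above N/3, the exponent 3 i - N - 1 is at most 2, so apart from the \<open>L\<close>-th
  power \<open>eis\<close> enters only through a constant.\<close>

lemma gap_coeff_le:
  assumes "N < 3 * i" "3 * i \<le> N + 3" "0 < s" "s < 1"
  shows "gap_coeff N (i + L) \<le> (60 + 268 * s + 180 * s^2 + 4 * s^3) * eis s ^ 2
     * ((eis s ^ 3 * phi s) / s) ^ L * (phi s / s) ^ i * s"
proof -
  have d: "fps_has_value (fps_deriv eis_fps) s (60 + 268 * s + 180 * s^2 + 4 * s^3)"
    unfolding deriv_eis_fps
    by (intro fps_has_value_add fps_has_value_mult fps_has_value_power fps_has_value_basic nonneg_fps_intros less_imp_le assms)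
  have e: "3 * (i + L) - N - 1 = 3 * L + (3 * i - N - 1)" "i + L - 1 = (i - 1) + L"
    using assms by auto
  have "gap_coeff N (i + L) \<le> (phi s ^ (i + L) * eis s ^ (3 * (i + L) - N - 1) * (60 + 268 * s + 180 * s^2 + 4 * s^3)) / s ^ (i + L - 1)"
    unfolding gap_coeff_def
    by (intro fps_nth_le_value nonneg_fps_intros nonneg_eis_fps nonneg_phi_fps fps_has_value_mult fps_has_value_power
        fps_has_value_eis fps_has_value_phi d less_imp_le assms)
  also have "\<dots> = (60 + 268 * s + 180 * s^2 + 4 * s^3) * eis s ^ (3 * i - N - 1)
     * ((eis s ^ 3 * phi s) / s) ^ L * (phi s / s) ^ i * s"
  proof -
    have "(phi s / s) ^ i * s = phi s ^ i / s ^ (i - 1)"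
      using assms by (cases i) (simp_all add: power_divide)
    moreover have "eis s ^ (3 * L + (3 * i - N - 1)) = (eis s ^ 3) ^ L * eis s ^ (3 * i - N - 1)"
      by (simp only: power_add power_mult)
    moreover have "phi s ^ (i + L) * (x ^ L * y) * z / s ^ (i - 1 + L)
        = z * y * (x * phi s / s) ^ L * (phi s ^ i / s ^ (i - 1))" for x y z
      by (simp add: power_add power_divide power_mult_distrib mult_ac)
    ultimately show ?thesis
      unfolding e(1,2) by (simp only: mult.assoc[of _ "(phi s / s) ^ i" s])
  qed
  also have "\<dots> \<le> (60 + 268 * s + 180 * s^2 + 4 * s^3) * eis s ^ 2
     * ((eis s ^ 3 * phi s) / s) ^ L * (phi s / s) ^ i * s"
    using assms eis_ge_1[of s] phi_ge_1[of s]
    by (intro mult_right_mono mult_left_mono power_increasing zero_le_power divide_nonneg_pos mult_nonneg_nonneg) auto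
  finally show ?thesis .
qed

text \<open>By the equation for \<open>r\<close> the mean of phi^i at \<open>r\<close> is exactly
  \<open>i\<close>, so each term of degree below \<open>i\<close> at \<open>s\<close> is at most
  r^(i-1) times the coefficient at \<open>i - 1\<close>. These \<open>i\<close> terms carry at least
  half of the value at \<open>s\<close> by the tail bound. The remaining factor, a power of
  \<open>eis_fps\<close> times its derivative, is coefficientwise at least 1.\<close>

lemma gap_coeff_ge:
  assumes "0 < i" and s: "0 < s" "s < r" "r \<le> 3/20" and r: "1 - r\<^sup>2 = r * (6 + 10 * r)"
    and i: "(phi r * s / (r * phi s)) ^ i \<le> 1/2"
  shows "phi s ^ i \<le> 2 * real i * r ^ (i - 1) * gap_coeff N i"
proof -
  define g where "g = phi_fps ^ i"
  have nonneg: "nonneg_fps g" unfolding g_def by (intro nonneg_fps_intros nonneg_phi_fps)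
  have val: "fps_has_value g t (phi t ^ i)" if "0 \<le> t" "t < 1" for t
    unfolding g_def using that by (intro fps_has_value_power nonneg_phi_fps fps_has_value_phi)
  have geo: "geometric_upto g r (i - 1)"
    using phi_power_geometric[of r 0 i "i - 1"] assms by (simp add: g_def of_nat_diff)
  have pos: "0 < phi s" "0 < phi r" using phi_ge_1[of s] phi_ge_1[of r] s by auto
  have "(s / r) ^ i * phi r ^ i = (phi r * s / (r * phi s)) ^ i * phi s ^ i"
    using pos by (simp add: power_divide power_mult_distrib)
  also have "\<dots> \<le> 1/2 * phi s ^ i" using i pos by (intro mult_right_mono) auto
  finally have "phi s ^ i / 2 \<le> phi s ^ i - (s / r) ^ i * phi r ^ i" by simp
  also have "\<dots> \<le> (\<Sum>l<i. g $ l * s ^ l)"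
    using s by (intro fps_partial_sum_ge nonneg val) auto
  also have "\<dots> \<le> (\<Sum>l<i. r ^ (i - 1) * g $ (i - 1))"
  proof (intro sum_mono)
    fix l assume "l \<in> {..<i}"
    then have l: "l + (i - 1 - l) = i - 1" by auto
    have "g $ l * s ^ l \<le> (r ^ (i - 1 - l) * g $ (i - 1)) * r ^ l"
      using geometric_upto_iterate[OF geo, of l "i - 1 - l"] l s nonneg
      by (intro mult_mono power_mono) (auto simp: nonneg_fps_def)
    also have "\<dots> = r ^ (l + (i - 1 - l)) * g $ (i - 1)" by (simp only: power_add mult_ac)
    finally show "g $ l * s ^ l \<le> r ^ (i - 1) * g $ (i - 1)" by (simp only: l)
  qed
  also have "\<dots> = real i * r ^ (i - 1) * g $ (i - 1)" by simp
  also have "g $ (i - 1) \<le> gap_coeff N i"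
  proof -
    have "nonneg_fps (eis_fps ^ n - 1)" for n
    proof (induction n)
      case (Suc n)
      have "eis_fps ^ Suc n - 1 = eis_fps * (eis_fps ^ n - 1) + (eis_fps - 1)" by (simp add: algebra_simps)
      moreover have "nonneg_fps (eis_fps - 1)" by (auto simp: eis_fps_def intro!: nonneg_fps_intros)
      ultimately show ?case using Suc by (simp only:) (intro nonneg_fps_add nonneg_fps_mult nonneg_eis_fps)
    qed (simp add: nonneg_fps_def)
    moreover have "nonneg_fps (fps_deriv eis_fps - 1)"
    proof -
      have "fps_deriv eis_fps - 1 = 59 + 268 * fps_X + 180 * fps_X ^ 2 + 4 * fps_X ^ 3"
        unfolding deriv_eis_fps by simp
      then show ?thesis by (simp only:) (intro nonneg_fps_intros)
    qed
    ultimately have "nonneg_fps (eis_fps ^ (3 * i - N - 1) * (fps_deriv eis_fps - 1) + (eis_fps ^ (3 * i - N - 1) - 1))"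
      by (intro nonneg_fps_add nonneg_fps_mult nonneg_fps_power nonneg_eis_fps)
    also have "eis_fps ^ (3 * i - N - 1) * (fps_deriv eis_fps - 1) + (eis_fps ^ (3 * i - N - 1) - 1)
      = eis_fps ^ (3 * i - N - 1) * fps_deriv eis_fps - 1" by (simp add: algebra_simps)
    finally have "(g * 1) $ (i - 1) \<le> (g * (eis_fps ^ (3 * i - N - 1) * fps_deriv eis_fps)) $ (i - 1)"
      by (intro fps_nth_mono_mult nonneg)
    then show ?thesis by (simp add: gap_coeff_def g_def mult.assoc)
  qed
  finally show ?thesis using s \<open>0 < i\<close> by (simp add: mult_left_mono)
qed

section \<open>The saddle point and the growth rate E^3 / D\<close>

lemma saddle_bounds: "1/10 < saddle" "saddle < 3/20"
proof -
  have "2236/1000 < sqrt 5" "sqrt 5 < 2237/1000"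
    using real_less_rsqrt[of "2236/1000" 5] real_less_lsqrt[of "2237/1000" 5] by (simp_all add: power2_eq_square)
  then show "1/10 < saddle" "saddle < 3/20" by (simp_all add: saddle_def)
qed

lemma saddle_eq: "11 * saddle\<^sup>2 + 6 * saddle = 1"
  by (simp add: saddle_def power2_eq_square algebra_simps add_divide_distrib diff_divide_distrib)

lemma DERIV_cusp: "(cusp has_real_derivative (1 + t) * (1 - t)^7 * (1 - 6 * t - 11 * t\<^sup>2)) (at t)"
proof -
  have "((\<lambda>t. t * (1 + t)^2 * (1 - t)^8) has_real_derivative
      (1 + t)^2 * (1 - t)^8 + t * (2 * (1 + t)) * (1 - t)^8 - t * (1 + t)^2 * (8 * (1 - t)^7)) (at t)"
    by (auto intro!: derivative_eq_intros) Groebner_Basis.algebra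
  moreover have "(1 + t)^2 * (1 - t)^8 + t * (2 * (1 + t)) * (1 - t)^8 - t * (1 + t)^2 * (8 * (1 - t)^7)
      = (1 + t) * (1 - t)^7 * (1 - 6 * t - 11 * t\<^sup>2)"
    by Groebner_Basis.algebra
  ultimately show ?thesis by (simp add: cusp_def[abs_def])
qed

lemma DERIV_eis: "(eis has_real_derivative 60 + 268 * t + 180 * t^2 + 4 * t^3) (at t)"
  unfolding eis_def by (auto intro!: derivative_eq_intros)

lemma cusp_less_saddle:
  assumes "0 < s" "s < saddle"
  shows "cusp s < cusp saddle"
proof (rule DERIV_pos_imp_increasing_open[OF assms(2)])
  fix t assume t: "s < t" "t < saddle"
  have "t\<^sup>2 < saddle\<^sup>2" using t assms by (intro power_strict_mono) auto
  then have "0 < 1 - 6 * t - 11 * t\<^sup>2" using saddle_eq t by linarith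
  then have "0 < (1 + t) * (1 - t)^7 * (1 - 6 * t - 11 * t\<^sup>2)"
    using t assms saddle_bounds by (intro mult_pos_pos zero_less_power) auto
  with DERIV_cusp show "\<exists>y. (cusp has_real_derivative y) (at t) \<and> 0 < y" by blast
qed (auto simp: cusp_def intro!: continuous_intros)

text \<open>Near 0 the derivative of \<open>cusp\<close> is close to 1, while that of
  \<open>eis ^ 3\<close> is multiplied by \<open>cusp s\<close>, at most 1/1000. The inequality is
  the cross-multiplied form of E^3 / D being decreasing there.\<close>

lemma eis_cusp_mono:
  assumes "0 < s" "s < t" "t \<le> 1/1000"
  shows "eis t ^ 3 * cusp s < eis s ^ 3 * cusp t"
proof -
  have "eis t ^ 3 * cusp s - eis s ^ 3 * cusp t < eis s ^ 3 * cusp s - eis s ^ 3 * cusp s"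
  proof (rule DERIV_neg_imp_decreasing[OF assms(2)])
    fix u assume u: "s \<le> u" "u \<le> t"
    define D where "D = 3 * eis u ^ 2 * (60 + 268 * u + 180 * u^2 + 4 * u^3) * cusp s
      - eis s ^ 3 * ((1 + u) * (1 - u)^7 * (1 - 6 * u - 11 * u\<^sup>2))"
    have "((\<lambda>u. eis u ^ 3 * cusp s - eis s ^ 3 * cusp u) has_real_derivative D) (at u)"
      unfolding D_def by (auto intro!: derivative_eq_intros DERIV_cusp DERIV_eis)
    moreover have "D < 0"
    proof -
      have u': "0 \<le> u" "u \<le> 1/1000" using u assms by auto
      have p: "u ^ j \<le> u" if "0 < j" for j using power_decreasing[of 1 j u] u' that by simp
      have "eis u \<le> 13/10" unfolding eis_def using p[of 2] p[of 3] p[of 4] u' by simp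
      then have "eis u ^ 2 \<le> (13/10)^2" using eis_ge_1[OF u'(1)] by (intro power_mono) auto
      moreover have "60 + 268 * u + 180 * u^2 + 4 * u^3 \<le> 61" using p[of 2] p[of 3] u' by simp
      moreover have "cusp s \<le> 1/1000"
      proof -
        have "cusp s = s * (((1 + s) * (1 - s))^2 * (1 - s)^6)" unfolding cusp_def by Groebner_Basis.algebra
        also have "\<dots> \<le> s * (1^2 * 1^6)"
        proof (intro mult_left_mono mult_mono power_mono)
          show "(1 + s) * (1 - s) \<le> 1" by (simp add: algebra_simps)
        qed (use assms in auto)
        finally show ?thesis using assms by simp
      qed
      moreover have "0 \<le> cusp s" using assms by (simp add: cusp_def)
      ultimately have 1: "3 * eis u ^ 2 * (60 + 268 * u + 180 * u^2 + 4 * u^3) * cusp s \<le> 3 * (13/10)^2 * 61 * (1/1000)"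
        using u' by (intro mult_mono) auto
      have "1 \<le> eis s ^ 3" using eis_ge_1[of s] assms by (intro one_le_power) auto
      moreover have "1 * ((999/1000)^7 * (9/10)) \<le> (1 + u) * ((1 - u)^7 * (1 - 6 * u - 11 * u\<^sup>2))"
        using u' p[of 2] by (intro mult_mono power_mono) auto
      ultimately have "1 * (1 * ((999/1000)^7 * (9/10))) \<le> eis s ^ 3 * ((1 + u) * ((1 - u)^7 * (1 - 6 * u - 11 * u\<^sup>2)))"
        using eis_ge_1[of s] assms by (intro mult_mono[of 1 "eis s ^ 3"]) auto
      then have 2: "1 * (1 * ((999/1000)^7 * (9/10))) \<le> eis s ^ 3 * ((1 + u) * (1 - u)^7 * (1 - 6 * u - 11 * u\<^sup>2))"
        by (simp only: mult.assoc)
      have "3 * (13/10)^2 * 61 * (1/1000) < 1 * (1 * ((999/1000)^7 * (9/10) :: real))"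
        by (simp add: power_divide)
      with 1 2 show ?thesis unfolding D_def by linarith
    qed
    ultimately show "\<exists>y. ((\<lambda>u. eis u ^ 3 * cusp s - eis s ^ 3 * cusp u) has_real_derivative y) (at u) \<and> y < 0"
      by blast
  qed
  then show ?thesis by simp
qed

text \<open>
  Below, \<open>\<tau> s\<close> is the mean from \<open>recurrence_geometric\<close> per unit of \<open>i\<close>; it is smallest for words without
  odd coordinates, so these alone determine the bound.
\<close>

lemma no_large_gap:
  fixes s1 \<epsilon> :: real
  defines "\<tau> \<equiv> \<lambda>s. s * (6 + 10 * s) / (1 - s\<^sup>2)"
  assumes s1: "0 < s1" "s1 < 1/1000" "eis s1 ^ 3 * cusp saddle = eis saddle ^ 3 * cusp s1" and \<epsilon>: "0 < \<epsilon>"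
  shows "\<exists>N0. \<forall>N\<ge>N0. \<forall>(W :: 'a set) k b c.
     (\<forall>w\<in>W. b w \<le> 2 * k w \<and> b w \<le> 2 * N \<and> ((1 - \<tau> s1) / 3 + \<epsilon>) * real N \<le> real (k w)) \<longrightarrow>
     1 + (\<Sum>w\<in>W. word_fps (k w) (b w)) \<noteq>
       (\<Sum>j\<le>N div 3. fps_const (c j) * (eis_fps ^ (N - 3 * j) * cusp_fps ^ j))"
proof -
  \<comment> \<open>By \<open>phi_cusp\<close> this is E^3 / D, the factor per unit of
    \<open>L\<close>.\<close>
  define H where "H = (\<lambda>s. eis s ^ 3 * phi s / s)"
  have \<tau>1: "0 \<le> \<tau> s1" "\<tau> s1 \<le> 1/4"
  proof -
    have s1': "s1\<^sup>2 \<le> s1" using s1 by (simp add: power2_eq_square mult_left_le)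
    then show "0 \<le> \<tau> s1" unfolding \<tau>_def using s1 by (intro divide_nonneg_nonneg mult_nonneg_nonneg) auto
    have "s1 * (6 + 10 * s1) = 6 * s1 + 10 * s1\<^sup>2" by (simp add: power2_eq_square algebra_simps)
    also have "\<dots> \<le> 1/4 * (1 - s1\<^sup>2)" using s1' s1 by simp
    finally show "\<tau> s1 \<le> 1/4" using s1' s1 by (simp add: \<tau>_def pos_divide_le_eq)
  qed
  \<comment> \<open>At s1 the rates of the words and of the zero word agree. A point
    \<open>s\<close> slightly to the left makes the former strictly larger and costs less than
    \<epsilon> in the mean.\<close>
  have "isCont \<tau> s1" unfolding \<tau>_def using s1 by (auto intro!: continuous_intros simp: power2_eq_1_iff)
  then have "(\<tau> \<longlongrightarrow> \<tau> s1) (at_left s1)" by (simp add: isCont_def filterlim_at_split)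
  then have "\<forall>\<^sub>F s in at_left s1. \<tau> s1 - \<epsilon> < \<tau> s"
    by (rule order_tendstoD) (use \<epsilon> in simp)
  moreover have "\<forall>\<^sub>F s in at_left s1. s \<in> {0<..<s1}"
    using s1 by (intro eventually_at_left_real)
  ultimately have "\<forall>\<^sub>F s in at_left s1. \<tau> s1 - \<epsilon> < \<tau> s \<and> s \<in> {0<..<s1}"
    by eventually_elim auto
  then have "\<exists>s. \<tau> s1 - \<epsilon> < \<tau> s \<and> s \<in> {0<..<s1}"
    by (rule eventually_happens'[OF trivial_limit_at_left_real])
  then obtain s where s: "\<tau> s1 - \<epsilon> < \<tau> s" "0 < s" "s < s1" by auto
  have Hcusp: "H t * cusp t = eis t ^ 3" if "0 < t" "t < 1" for t
    using phi_cusp[OF that] that by (simp add: H_def field_simps)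
  have cusp_pos: "0 < cusp t" if "0 < t" "t < 1" for t
    using that by (simp add: cusp_def)
  have H_less: "H saddle < H s"
  proof -
    have "eis saddle ^ 3 * (cusp s * cusp s1) = (eis s1 ^ 3 * cusp s) * cusp saddle"
      using s1(3) by (metis mult.assoc mult.commute)
    also have "\<dots> < (eis s ^ 3 * cusp s1) * cusp saddle"
      using eis_cusp_mono[of s s1] s s1 cusp_pos[of saddle] saddle_bounds by (intro mult_strict_right_mono) auto
    finally have "cusp s1 * (eis saddle ^ 3 * cusp s) < cusp s1 * (eis s ^ 3 * cusp saddle)"
      by (simp only: mult_ac)
    then have "eis saddle ^ 3 * cusp s < eis s ^ 3 * cusp saddle"
      using cusp_pos[of s1] s1 by simp
    moreover have "H saddle * (cusp saddle * cusp s) = eis saddle ^ 3 * cusp s"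
      using Hcusp[of saddle] saddle_bounds by (simp add: mult.assoc[symmetric])
    moreover have "H s * (cusp saddle * cusp s) = (H s * cusp s) * cusp saddle"
      by (simp only: mult_ac)
    then have "H s * (cusp saddle * cusp s) = eis s ^ 3 * cusp saddle"
      using Hcusp[of s] s s1 by simp
    ultimately have "H saddle * (cusp saddle * cusp s) < H s * (cusp saddle * cusp s)"
      by (simp only:)
    then show ?thesis
      using cusp_pos[of saddle] cusp_pos[of s] s s1 saddle_bounds by (simp add: mult_less_cancel_right)
  qed
  have H_pos: "0 < H saddle"
    using eis_ge_1[of saddle] phi_ge_1[of saddle] saddle_bounds by (simp add: H_def)
  \<comment> \<open>\<open>L\<close> will be about i / M, hence at most \<epsilon> i + 3, and the
    gain of the words over the zero word is at least \<beta>^i.\<close>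
  obtain M :: nat where M: "0 < M" "1 / real M \<le> \<epsilon>"
    using ex_inverse_of_nat_less[OF \<epsilon>] by (auto simp: inverse_eq_divide intro: less_imp_le)
  define \<beta> where "\<beta> = root M (H s / H saddle)"
  have \<beta>: "1 < \<beta>" "\<beta> ^ M = H s / H saddle"
    using H_less H_pos M by (simp_all add: \<beta>_def real_root_pow_pos)
  \<comment> \<open>The lower bound for the gap coefficient has to be taken strictly to the left of
    the saddle point and loses (phi a / phi saddle)^i. For \<open>a\<close> close enough \<beta>^i
    outweighs this.\<close>
  have "isCont (\<lambda>t. \<beta> * phi t / phi saddle) saddle"
    unfolding phi_def using saddle_bounds by (auto intro!: continuous_intros simp: power2_eq_1_iff)
  then have "((\<lambda>t. \<beta> * phi t / phi saddle) \<longlongrightarrow> \<beta> * phi saddle / phi saddle) (at_left saddle)"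
    by (simp add: isCont_def filterlim_at_split)
  then have "\<forall>\<^sub>F t in at_left saddle. 1 < \<beta> * phi t / phi saddle"
    by (rule order_tendstoD) (use \<beta> phi_ge_1[of saddle] saddle_bounds in simp)
  moreover have "\<forall>\<^sub>F t in at_left saddle. t \<in> {0<..<saddle}"
    using saddle_bounds by (intro eventually_at_left_real) simp
  ultimately have "\<forall>\<^sub>F t in at_left saddle. 1 < \<beta> * phi t / phi saddle \<and> t \<in> {0<..<saddle}"
    by eventually_elim auto
  then have "\<exists>t. 1 < \<beta> * phi t / phi saddle \<and> t \<in> {0<..<saddle}"
    by (rule eventually_happens'[OF trivial_limit_at_left_real])
  then obtain a where a: "1 < \<beta> * phi a / phi saddle" "0 < a" "a < saddle" by auto
  have phi_pos: "0 < phi a" "0 < phi saddle"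
    using phi_ge_1[of a] phi_ge_1[of saddle] a saddle_bounds by auto
  define \<theta> where "\<theta> = \<beta> * phi a / phi saddle"
  define \<rho> where "\<rho> = phi saddle * a / (saddle * phi a)"
  have \<rho>: "0 \<le> \<rho>" "\<rho> < 1"
  proof -
    have "phi saddle * a * cusp a < phi saddle * a * cusp saddle"
      using cusp_less_saddle[of a] a phi_pos by (intro mult_strict_left_mono) auto
    also have "phi saddle * a * cusp saddle = saddle * a"
      using phi_cusp[of saddle] saddle_bounds by (simp add: mult_ac)
    also have "\<dots> = (saddle * phi a) * cusp a"
      using phi_cusp[of a] a saddle_bounds by (simp add: mult_ac)
    finally have "phi saddle * a < saddle * phi a"
      using cusp_pos[of a] a saddle_bounds by (simp add: mult_less_cancel_right)
    then show "0 \<le> \<rho>" "\<rho> < 1" using phi_pos a saddle_bounds by (auto simp: \<rho>_def)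
  qed
  define K where "K = (60 + 268 * saddle + 180 * saddle^2 + 4 * saddle^3) * eis saddle ^ 2"
  have K: "0 < K" using saddle_bounds eis_ge_1[of saddle] by (auto simp: K_def intro!: mult_pos_pos add_pos_pos)
  have \<theta>: "1 < \<theta>" using a by (simp add: \<theta>_def)
  then have "(\<lambda>i. real i * (1 / \<theta>) ^ i) \<longlonglongrightarrow> 0"
    using powser_times_n_limit_0[of "1 / \<theta>"] by simp
  then have ev1: "\<forall>\<^sub>F i in sequentially. real i * (1 / \<theta>) ^ i < 1 / (16 * K)"
    by (rule order_tendstoD) (use K in simp)
  have "(\<lambda>i. \<rho> ^ i) \<longlonglongrightarrow> 0" using \<rho> by (intro LIMSEQ_realpow_zero) auto
  then have ev2: "\<forall>\<^sub>F i in sequentially. \<rho> ^ i < 1/2"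
    by (rule order_tendstoD) simp
  \<comment> \<open>The first bound treats the words with k \<ge> i + L, for which the truncated
    difference is 0. In the second, the gap hypothesis supplies 3 \<epsilon> i; the choice of
    \<open>L\<close> and that of \<open>s\<close> use \<epsilon> i each, and the third \<epsilon> i
    absorbs the constant 5 + 3 \<epsilon>.\<close>
  have ev3: "\<forall>\<^sub>F i in sequentially. real i \<ge> max (1 / \<tau> s) ((5 + 3 * \<epsilon>) / \<epsilon>)"
    by (rule eventually_compose_filterlim[OF _ filterlim_real_sequentially]) (rule eventually_ge_at_top)
  obtain I where I: "\<And>i. i \<ge> I \<Longrightarrow> real i * (1 / \<theta>) ^ i < 1 / (16 * K) \<and> \<rho> ^ i < 1/2
      \<and> real i \<ge> max (1 / \<tau> s) ((5 + 3 * \<epsilon>) / \<epsilon>)"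
    using eventually_conj[OF ev1 eventually_conj[OF ev2 ev3]] by (auto simp: eventually_sequentially)
  show ?thesis
  proof (intro exI[of _ "3 * I + 1"] allI impI notI)
    fix N and W :: "'a set" and k b :: "'a \<Rightarrow> nat" and c
    assume N0: "3 * I + 1 \<le> N"
      and W: "\<forall>w\<in>W. b w \<le> 2 * k w \<and> b w \<le> 2 * N \<and> ((1 - \<tau> s1) / 3 + \<epsilon>) * real N \<le> real (k w)"
      and eq: "1 + (\<Sum>w\<in>W. word_fps (k w) (b w)) =
       (\<Sum>j\<le>N div 3. fps_const (c j) * (eis_fps ^ (N - 3 * j) * cusp_fps ^ j))"
    define i where "i = N div 3 + 1"
    define L where "L = i div M + 3"
    have i: "N < 3 * i" "3 * i \<le> N + 3" "0 < i" "I \<le> i" "0 < N"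
      using N0 by (auto simp: i_def)
    note I = I[OF i(4)]
    have L: "3 \<le> L" "i \<le> M * L" "real L \<le> \<epsilon> * real i + 3"
    proof -
      show "3 \<le> L" by (simp add: L_def)
      have "i < M * (i div M) + M" using M by (metis add.commute mod_less_divisor mult_div_mod_eq nat_add_left_cancel_less)
      then show "i \<le> M * L" by (simp add: L_def add_mult_distrib2)
      have "real (i div M) \<le> 1 / real M * real i" using of_nat_div_le_of_nat[of i M] by simp
      also have "\<dots> \<le> \<epsilon> * real i" using M by (intro mult_right_mono) auto
      finally show "real L \<le> \<epsilon> * real i + 3" by (simp add: L_def)
    qed
    have s2: "s\<^sup>2 < 1" using s s1 by (simp add: power_less_one_iff)
    have \<tau>s: "0 < \<tau> s" using s s2 by (simp add: \<tau>_def)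
    have words: "real N \<le> 4 * real (k w)" "(real (i + L - k w) + 1) * (1 - s\<^sup>2) \<le> real i * (s * (6 + 10 * s))"
      if "w \<in> W" for w
    proof -
      have kw: "((1 - \<tau> s1) / 3 + \<epsilon>) * real N \<le> real (k w)" using W that by blast
      have "1/4 * real N \<le> ((1 - \<tau> s1) / 3 + \<epsilon>) * real N"
      proof (rule mult_right_mono)
        have "1/4 = (1 - 1/4) / (3 :: real)" by simp
        also have "\<dots> \<le> (1 - \<tau> s1) / 3" using \<tau>1 by (intro divide_right_mono) auto
        also have "\<dots> \<le> (1 - \<tau> s1) / 3 + \<epsilon>" using \<epsilon> by simp
        finally show "1/4 \<le> (1 - \<tau> s1) / 3 + \<epsilon>" .
      qed simp
      from order_trans[OF this kw] show "real N \<le> 4 * real (k w)" by simp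
      have "real (i + L - k w) + 1 \<le> real i * \<tau> s"
      proof (cases "i + L \<le> k w")
        case True
        with I \<tau>s show ?thesis by (simp add: pos_divide_le_eq)
      next
        case False
        have "((1 - \<tau> s1) / 3 + \<epsilon>) * (3 * (real i - 1)) \<le> ((1 - \<tau> s1) / 3 + \<epsilon>) * real N"
          using \<tau>1 \<epsilon> i by (intro mult_left_mono) auto
        from order_trans[OF this kw] have "(((1 - \<tau> s1) / 3 + \<epsilon>) * 3) * (real i - 1) \<le> real (k w)"
          by (simp only: mult.assoc)
        also have "((1 - \<tau> s1) / 3 + \<epsilon>) * 3 = 1 - \<tau> s1 + 3 * \<epsilon>" by (simp add: distrib_right)
        finally have "(1 - \<tau> s1 + 3 * \<epsilon>) * (real i - 1) \<le> real (k w)" .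
        moreover have "(5 + 3 * \<epsilon>) \<le> real i * \<epsilon>" using I \<epsilon> by (simp add: pos_divide_le_eq)
        moreover have "real i * (\<tau> s1 - \<epsilon>) \<le> real i * \<tau> s" using s by (intro mult_left_mono) auto
        ultimately show ?thesis using False L(3) \<tau>1 by (simp add: of_nat_diff algebra_simps)
      qed
      with s2 show "(real (i + L - k w) + 1) * (1 - s\<^sup>2) \<le> real i * (s * (6 + 10 * s))"
        by (simp add: \<tau>_def pos_le_divide_eq)
    qed
    have "1/8 * H s ^ L * gap_coeff N i \<le> gap_coeff N (i + L)"
      unfolding H_def using s s1 L i W words
      by (intro gap_coeff_compare[OF eq]) auto
    also have "\<dots> \<le> K * H saddle ^ L * (phi saddle / saddle) ^ i * saddle"
      unfolding K_def H_def using i saddle_bounds by (intro gap_coeff_le) auto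
    finally have 1: "1/8 * H s ^ L * gap_coeff N i \<le> K * H saddle ^ L * (phi saddle / saddle) ^ i * saddle" .
    have 2: "phi a ^ i \<le> 2 * real i * saddle ^ (i - 1) * gap_coeff N i"
      using i a saddle_bounds saddle_eq I by (intro gap_coeff_ge) (auto simp: \<rho>_def power2_eq_square algebra_simps)
    \<comment> \<open>Both bounds for the gap coefficient are now chained; the powers at
      \<open>saddle\<close> cancel and leave \<theta>^i \<le> 16 K i, impossible for large
      \<open>i\<close>.\<close>
    have "H s ^ L * phi a ^ i \<le> H s ^ L * (2 * real i * saddle ^ (i - 1) * gap_coeff N i)"
      using 2 H_less H_pos by (intro mult_left_mono) auto
    also have "\<dots> = 16 * real i * saddle ^ (i - 1) * (1/8 * H s ^ L * gap_coeff N i)" by simp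
    also have "\<dots> \<le> 16 * real i * saddle ^ (i - 1) * (K * H saddle ^ L * (phi saddle / saddle) ^ i * saddle)"
      using 1 saddle_bounds by (intro mult_left_mono) auto
    also have "\<dots> = 16 * K * real i * H saddle ^ L * phi saddle ^ i"
    proof -
      have "saddle ^ (i - 1) * saddle = saddle ^ i" using i by (cases i) auto
      moreover have "saddle ^ i * (phi saddle / saddle) ^ i = phi saddle ^ i"
        using saddle_bounds by (simp add: power_divide)
      ultimately show ?thesis by (simp add: mult_ac) (simp add: mult.assoc[symmetric])?
    qed
    finally have "(H s / H saddle) ^ L * (phi a / phi saddle) ^ i \<le> 16 * K * real i"
      using H_pos phi_pos by (simp add: power_divide field_simps)
    moreover have "\<beta> ^ i \<le> (H s / H saddle) ^ L"
      unfolding \<beta>(2)[symmetric] power_mult[symmetric] using \<beta>(1) L(2) by (intro power_increasing) auto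
    then have "\<beta> ^ i * (phi a / phi saddle) ^ i \<le> (H s / H saddle) ^ L * (phi a / phi saddle) ^ i"
      using phi_pos by (intro mult_right_mono) auto
    ultimately have "\<theta> ^ i \<le> 16 * K * real i"
      by (simp add: \<theta>_def power_divide power_mult_distrib)
    moreover have "16 * K * real i < \<theta> ^ i"
      using I K \<theta> by (simp add: power_divide field_simps)
    ultimately show False by simp
  qed
qed

unbundle no fps_syntax
notation vec_index (infixl \<open>$\<close> 100)

section \<open>Weight enumerators of self-dual codes\<close>

lemma z4_cases: obtains "a = 0" | "a = 1" | "a = 2" | "a = (3 :: z4)"
proof -
  obtain z where "a = of_int z" "0 \<le> z" "z < 4" by (cases a) auto
  then have "z \<in> {0,1,2,3}" by auto
  then show ?thesis using that \<open>a = of_int z\<close> by auto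
qed

lemma UNIV_z4: "(UNIV :: z4 set) = {0, 1, 2, 3}"
  by (auto intro: z4_cases)

definition z4_char :: "z4 \<Rightarrow> complex" where
  "z4_char a = (if a = 0 then 1 else if a = 1 then \<i> else if a = 2 then -1 else -\<i>)"

lemma z4_char_add: "z4_char (a + b) = z4_char a * z4_char b"
  by (cases a rule: z4_cases; cases b rule: z4_cases) (simp_all add: z4_char_def)

lemma z4_char_eq_1_iff: "z4_char a = 1 \<longleftrightarrow> a = 0"
  by (auto simp: z4_char_def complex_eq_iff)

lemma z4_char_sum: "finite A \<Longrightarrow> z4_char (sum f A) = (\<Prod>i\<in>A. z4_char (f i))"
  by (induction A rule: finite_induct) (simp_all add: z4_char_add, simp add: z4_char_def)

definition letter_weight :: "complex \<Rightarrow> complex \<Rightarrow> complex \<Rightarrow> z4 \<Rightarrow> complex" where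
  "letter_weight x y z a = (if a = 0 then x else if a = 2 then z else y)"

text \<open>The symmetrized weight enumerator: the coordinates 1 and 3 share the variable
  \<open>y\<close>.\<close>

definition swe :: "nat \<Rightarrow> z4 vec set \<Rightarrow> complex \<Rightarrow> complex \<Rightarrow> complex \<Rightarrow> complex" where
  "swe n C x y z = (\<Sum>c\<in>C. \<Prod>i<n. letter_weight x y z (c $ i))"

lemma letter_weight_transform:
  "(\<Sum>b\<in>UNIV. z4_char (a * b) * letter_weight x y z b) = letter_weight (x + 2 * y + z) (x - z) (x - 2 * y + z) a"
  unfolding UNIV_z4 by (cases a rule: z4_cases) (simp_all add: z4_char_def letter_weight_def)

lemma bij_betw_vec_PiE: "bij_betw (\<lambda>g. vec n g) (PiE {..<n} (\<lambda>_. UNIV)) (carrier_vec n :: z4 vec set)"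
  by (rule bij_betwI[where g = "\<lambda>v. restrict (\<lambda>i. v $ i) {..<n}"]) (auto simp: PiE_def extensional_def)

lemma finite_carrier_vec_z4: "finite (carrier_vec n :: z4 vec set)"
  using bij_betw_finite[OF bij_betw_vec_PiE[of n]] by (simp add: finite_PiE)

lemma character_sum:
  assumes "z4_linear_code n C" "v \<in> carrier_vec n"
  shows "(\<Sum>c\<in>C. z4_char (v \<bullet> c)) = (if v \<in> dual_code n C then of_nat (card C) else 0)"
proof (cases "v \<in> dual_code n C")
  case True
  then have "z4_char (v \<bullet> c) = 1" if "c \<in> C" for c
    using that by (simp add: dual_code_def z4_char_eq_1_iff)
  with True show ?thesis by simp
next
  case False
  from assms have C: "C \<subseteq> carrier_vec n" "\<And>u w. u \<in> C \<Longrightarrow> w \<in> C \<Longrightarrow> u + w \<in> C"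
    by (auto simp: z4_linear_code_def)
  have fin: "finite C" using C(1) finite_carrier_vec_z4 by (rule finite_subset)
  from False assms(2) obtain c0 where c0: "c0 \<in> C" "v \<bullet> c0 \<noteq> 0"
    by (auto simp: dual_code_def)
  have inj: "inj_on (\<lambda>c. c + c0) C"
  proof (rule inj_onI)
    fix c d assume cd: "c \<in> C" "d \<in> C" "c + c0 = d + c0"
    then have "c \<in> carrier_vec n" "d \<in> carrier_vec n" "c0 \<in> carrier_vec n" using C c0 by auto
    moreover have "c $ i = d $ i" if "i < n" for i
      using arg_cong[OF cd(3), of "\<lambda>u. u $ i"] calculation that by simp
    ultimately show "c = d" by (intro eq_vecI) auto
  qed
  have img: "(\<lambda>c. c + c0) ` C = C"
    using C(2) c0(1) by (intro endo_inj_surj fin inj) auto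
  have "(\<Sum>c\<in>C. z4_char (v \<bullet> c)) = (\<Sum>c\<in>(\<lambda>c. c + c0) ` C. z4_char (v \<bullet> c))"
    by (simp add: img)
  also have "\<dots> = (\<Sum>c\<in>C. z4_char (v \<bullet> (c + c0)))"
    by (subst sum.reindex[OF inj]) simp
  also have "\<dots> = z4_char (v \<bullet> c0) * (\<Sum>c\<in>C. z4_char (v \<bullet> c))"
    unfolding sum_distrib_left
  proof (rule sum.cong[OF refl])
    fix c assume "c \<in> C"
    then have "v \<bullet> (c + c0) = v \<bullet> c + v \<bullet> c0"
      using C c0 assms(2) by (intro scalar_prod_add_distrib[of _ n]) auto
    then show "z4_char (v \<bullet> (c + c0)) = z4_char (v \<bullet> c0) * z4_char (v \<bullet> c)"
      by (simp add: z4_char_add)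
  qed
  finally have "(1 - z4_char (v \<bullet> c0)) * (\<Sum>c\<in>C. z4_char (v \<bullet> c)) = 0"
    by (simp add: algebra_simps)
  with c0 False show ?thesis by (auto simp: z4_char_eq_1_iff)
qed

text \<open>The transformed letter weights are Fourier transforms on the alphabet. After
  interchanging the sums, the sum of characters over the code selects the words of the dual.\<close>

lemma swe_MacWilliams:
  assumes "self_dual_code n C"
  shows "swe n C (x + 2 * y + z) (x - z) (x - 2 * y + z) = of_nat (card C) * swe n C x y z"
proof -
  have lin: "z4_linear_code n C" and dual: "dual_code n C = C"
    using assms by (auto simp: self_dual_code_def)
  have sub: "C \<subseteq> carrier_vec n" using lin by (simp add: z4_linear_code_def)
  let ?w = "\<lambda>v. \<Prod>i<n. letter_weight x y z (v $ i)"
  have expand: "(\<Prod>i<n. letter_weight (x + 2 * y + z) (x - z) (x - 2 * y + z) (c $ i))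
      = (\<Sum>v\<in>carrier_vec n. z4_char (v \<bullet> c) * ?w v)" if "c \<in> C" for c
  proof -
    have dim: "dim_vec c = n" using that sub by auto
    have "(\<Prod>i<n. letter_weight (x + 2 * y + z) (x - z) (x - 2 * y + z) (c $ i))
       = (\<Prod>i<n. \<Sum>b\<in>UNIV. z4_char (c $ i * b) * letter_weight x y z b)"
      by (simp add: letter_weight_transform)
    also have "\<dots> = (\<Sum>g\<in>PiE {..<n} (\<lambda>_. UNIV). \<Prod>i<n. z4_char (c $ i * g i) * letter_weight x y z (g i))"
      by (intro prod_sum_PiE) auto
    also have "\<dots> = (\<Sum>g\<in>PiE {..<n} (\<lambda>_. UNIV). z4_char (vec n g \<bullet> c) * ?w (vec n g))"
      using dim by (intro sum.cong refl)
        (simp add: scalar_prod_def z4_char_sum prod.distrib atLeast0LessThan mult.commute)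
    also have "\<dots> = (\<Sum>v\<in>carrier_vec n. z4_char (v \<bullet> c) * ?w v)"
      by (rule sum.reindex_bij_betw[OF bij_betw_vec_PiE])
    finally show ?thesis .
  qed
  have "swe n C (x + 2 * y + z) (x - z) (x - 2 * y + z) = (\<Sum>c\<in>C. \<Sum>v\<in>carrier_vec n. z4_char (v \<bullet> c) * ?w v)"
    unfolding swe_def by (intro sum.cong refl expand)
  also have "\<dots> = (\<Sum>v\<in>carrier_vec n. (\<Sum>c\<in>C. z4_char (v \<bullet> c)) * ?w v)"
    by (subst sum.swap) (simp add: sum_distrib_right)
  also have "\<dots> = (\<Sum>v\<in>carrier_vec n. if v \<in> C then of_nat (card C) * ?w v else 0)"
    by (intro sum.cong refl) (simp add: character_sum[OF lin] dual)
  also have "\<dots> = (\<Sum>v\<in>C. of_nat (card C) * ?w v)"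
    using sub by (intro sum.mono_neutral_cong_right finite_carrier_vec_z4) auto
  finally show ?thesis by (simp add: swe_def sum_distrib_left)
qed

lemma letter_weight_scale: "letter_weight (t * x) (t * y) (t * z) a = t * letter_weight x y z a"
  by (simp add: letter_weight_def)

lemma swe_scale: "swe n C (t * x) (t * y) (t * z) = t ^ n * swe n C x y z"
  unfolding swe_def letter_weight_scale by (simp add: prod.distrib sum_distrib_left)

lemma swe_zero_word:
  assumes "z4_linear_code n C"
  shows "swe n C x 0 0 = x ^ n"
proof -
  have sub: "C \<subseteq> carrier_vec n" and "0\<^sub>v n \<in> C" using assms by (auto simp: z4_linear_code_def)
  have fin: "finite C" using sub finite_carrier_vec_z4 by (rule finite_subset)
  have "(\<Prod>i<n. letter_weight x 0 0 (c $ i)) = (if c = 0\<^sub>v n then x ^ n else 0)" if "c \<in> C" for c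
  proof (cases "c = 0\<^sub>v n")
    case False
    have "\<exists>i<n. c $ i \<noteq> 0"
    proof (rule ccontr)
      assume "\<not> ?thesis"
      then have "c = 0\<^sub>v n" using that sub by (intro eq_vecI) auto
      with False show False ..
    qed
    then show ?thesis using False by (auto intro!: prod_zero simp: letter_weight_def)
  qed (simp add: letter_weight_def)
  then have "swe n C x 0 0 = (\<Sum>c\<in>C. if c = 0\<^sub>v n then x ^ n else 0)"
    unfolding swe_def by (intro sum.cong refl)
  then show ?thesis using fin \<open>0\<^sub>v n \<in> C\<close> by simp
qed

text \<open>The MacWilliams identity is used twice, from (1,0,0) to (1,1,1) and on to (4,0,0); at
  the first and the last point only the zero word counts.\<close>

lemma card_self_dual:
  assumes "self_dual_code n C"
  shows "card C = 2 ^ n"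
proof -
  have lin: "z4_linear_code n C" using assms by (simp add: self_dual_code_def)
  have "swe n C 4 0 0 = of_nat (card C) * swe n C 1 1 1"
    using swe_MacWilliams[OF assms, of 1 1 1] by simp
  also have "swe n C 1 1 1 = of_nat (card C) * swe n C 1 0 0"
    using swe_MacWilliams[OF assms, of 1 0 0] by simp
  finally have "(4::complex) ^ n = of_nat (card C * card C)"
    by (simp add: swe_zero_word[OF lin])
  then have "of_nat (4 ^ n) = (of_nat (card C * card C) :: complex)" by simp
  then have "4 ^ n = card C * card C" by (simp only: of_nat_eq_iff)
  then have "(2 ^ n)\<^sup>2 = (card C)\<^sup>2" by (simp add: power2_eq_square power_mult_distrib[symmetric])
  then show ?thesis by (simp add: power2_eq_iff_nonneg)
qed

lemma swe_self_dual:
  assumes "self_dual_code n C"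
  shows "swe n C ((x + 2 * y + z) / 2) ((x - z) / 2) ((x - 2 * y + z) / 2) = swe n C x y z"
proof -
  have "2 ^ n * swe n C ((x + 2 * y + z) / 2) ((x - z) / 2) ((x - 2 * y + z) / 2)
    = swe n C (x + 2 * y + z) (x - z) (x - 2 * y + z)"
  proof -
    have "2 * (u / 2) = u" for u :: complex by simp
    then show ?thesis by (simp only: swe_scale[symmetric])
  qed
  also have "\<dots> = 2 ^ n * swe n C x y z"
    using swe_MacWilliams[OF assms] card_self_dual[OF assms] by simp
  finally show ?thesis by simp
qed

section \<open>The enumerator in terms of the numbers of odd coordinates and of coordinates
  2\<close>

definition twos :: "z4 vec \<Rightarrow> nat" where
  "twos c = card {i. i < dim_vec c \<and> c $ i = 2}"

definition units :: "z4 vec \<Rightarrow> nat" where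
  "units c = card {i. i < dim_vec c \<and> c $ i \<noteq> 0 \<and> c $ i \<noteq> 2}"

lemma euclidean_weight_eq: "euclidean_weight c = units c + 4 * twos c"
proof -
  have "euclidean_weight c = (\<Sum>i<dim_vec c. (if c $ i \<noteq> 0 \<and> c $ i \<noteq> 2 then 1 else 0) + 4 * (if c $ i = 2 then 1 else 0))"
    unfolding euclidean_weight_def by (intro sum.cong refl) (simp add: euclidean_weight_z4_def)
  also have "\<dots> = units c + 4 * twos c"
    unfolding sum.distrib sum_distrib_left[symmetric] units_def twos_def
    by (simp add: sum.If_cases Int_def lessThan_def conj_commute)
  finally show ?thesis .
qed

lemma units_twos_le: "units c + twos c \<le> dim_vec c"
proof -
  have "units c + twos c = card ({i. i < dim_vec c \<and> c $ i \<noteq> 0 \<and> c $ i \<noteq> 2} \<union> {i. i < dim_vec c \<and> c $ i = 2})"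
    unfolding units_def twos_def by (subst card_Un_disjoint) auto
  also have "\<dots> \<le> card {..<dim_vec c}" by (intro card_mono) auto
  finally show ?thesis by simp
qed

lemma prod_letter_weight:
  assumes "dim_vec c = n"
  shows "(\<Prod>i<n. letter_weight x y z (c $ i)) = x ^ (n - units c - twos c) * y ^ units c * z ^ twos c"
proof -
  let ?U = "{i. i < n \<and> c $ i \<noteq> 0 \<and> c $ i \<noteq> 2}" and ?T = "{i. i < n \<and> c $ i = 2}" and ?Z = "{i. i < n \<and> c $ i = 0}"
  have part: "{..<n} = ?Z \<union> (?U \<union> ?T)" by auto
  have "card {..<n} = card ?Z + (card ?U + card ?T)"
    by (subst part, subst card_Un_disjoint; (subst card_Un_disjoint)?) auto
  then have Z: "card ?Z = n - units c - twos c" by (simp add: units_def twos_def assms)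
  have "(\<Prod>i<n. letter_weight x y z (c $ i))
     = (\<Prod>i\<in>?Z. letter_weight x y z (c $ i)) * ((\<Prod>i\<in>?U. letter_weight x y z (c $ i)) * (\<Prod>i\<in>?T. letter_weight x y z (c $ i)))"
    by (subst part, subst prod.union_disjoint; (subst prod.union_disjoint)?) auto
  also have "\<dots> = x ^ card ?Z * (y ^ card ?U * z ^ card ?T)"
    by (simp add: letter_weight_def)
  finally show ?thesis unfolding Z by (simp add: units_def twos_def assms)
qed

lemma swe_eq_sum:
  assumes "C \<subseteq> carrier_vec n"
  shows "swe n C x y z = (\<Sum>c\<in>C. x ^ (n - units c - twos c) * y ^ units c * z ^ twos c)"
  unfolding swe_def using assms by (intro sum.cong refl prod_letter_weight) auto

lemma type_II_units:
  assumes "type_II_code n C" "c \<in> C"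
  shows "units c = 4 * (units c div 4)" "even (units c div 4 + twos c)"
    "euclidean_weight c = 4 * (units c div 4 + twos c)"
proof -
  have "8 dvd units c + 4 * twos c"
    using assms by (simp add: type_II_code_def euclidean_weight_eq)
  then show "units c = 4 * (units c div 4)" "even (units c div 4 + twos c)"
    "euclidean_weight c = 4 * (units c div 4 + twos c)"
    unfolding euclidean_weight_eq by presburger+
qed

section \<open>Invariants of the anharmonic group\<close>

lemma poly_eqI_cofinite:
  fixes p q :: "complex poly"
  assumes "finite A" "\<And>x. x \<notin> A \<Longrightarrow> poly p x = poly q x"
  shows "p = q"
proof (rule ccontr)
  assume "p \<noteq> q"
  then have "finite {x. poly (p - q) x = 0}" by (intro poly_roots_finite) simp
  moreover have "UNIV \<subseteq> A \<union> {x. poly (p - q) x = 0}" using assms(2) by auto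
  ultimately have "finite (UNIV :: complex set)"
    using assms(1) by (meson finite_UnI finite_subset)
  then show False using infinite_UNIV_char_0 by blast
qed

text \<open>For k > m the reflected polynomial would be divisible by X, but its constant term is the
  leading coefficient of \<open>h\<close>.\<close>

lemma poly_reciprocal_degree:
  fixes h :: "complex poly"
  assumes "h \<noteq> 0" "\<And>x. x \<noteq> 0 \<Longrightarrow> x \<noteq> 1 \<Longrightarrow> x ^ m * poly h (1 / x) = x ^ k * poly h x"
  shows "k \<le> m"
proof (rule ccontr)
  assume "\<not> k \<le> m"
  then have k: "k = m + Suc (k - m - 1)" by simp
  have "reflect_poly h = [:0, 1:] ^ (Suc (k - m - 1) + degree h) * h"
  proof (rule poly_eqI_cofinite[of "{0, 1}"])
    fix x :: complex assume x: "x \<notin> {0, 1}"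
    have "x ^ m * poly (reflect_poly h) x = x ^ m * (x ^ degree h * poly h (1 / x))"
      using x by (simp add: poly_reflect_poly_nz inverse_eq_divide)
    also have "\<dots> = x ^ degree h * (x ^ k * poly h x)"
      using assms(2)[of x] x by simp
    also have "\<dots> = x ^ m * (x ^ (Suc (k - m - 1) + degree h) * poly h x)"
      by (subst k) (simp only: power_add mult_ac)
    finally show "poly (reflect_poly h) x = poly ([:0, 1:] ^ (Suc (k - m - 1) + degree h) * h) x"
      using x by simp
  qed simp
  then have "poly (reflect_poly h) 0 = 0" by simp
  with assms(1) show False by (simp add: poly_0_coeff_0)
qed

text \<open>
  After subtracting a multiple of \<open>E^N\<close> the polynomial vanishes at 0, and to even order because the
  group contains the reflection \<open>x \<mapsto> x / (x - 1)\<close> fixing 0; so \<open>(x (1 - x))^2\<close> splits off.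
\<close>

lemma anharmonic_invariant_decomposition:
  fixes g :: "complex poly"
  assumes "\<And>x. poly g (1 - x) = poly g x"
    and "\<And>x. x \<noteq> 0 \<Longrightarrow> x \<noteq> 1 \<Longrightarrow> x ^ (2 * N) * poly g (1 / x) = poly g x"
  shows "\<exists>c. \<forall>x. poly g x = (\<Sum>j\<le>N div 3. c j * (1 - x + x\<^sup>2) ^ (N - 3 * j) * (x * (1 - x)) ^ (2 * j))"
  using assms
proof (induction N arbitrary: g rule: less_induct)
  case (less N g)
  define E :: "complex poly" where "E = [:1, -1, 1:]"
  have E: "poly E x = 1 - x + x\<^sup>2" for x by (simp add: E_def power2_eq_square algebra_simps)
  define h where "h = g - smult (poly g 0) (E ^ N)"
  have h: "poly h x = poly g x - poly g 0 * (1 - x + x\<^sup>2) ^ N" for x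
    by (simp add: h_def E)
  have h1: "poly h (1 - x) = poly h x" for x
    by (simp add: h less.prems(1) power2_eq_square algebra_simps)
  have h2: "x ^ (2 * N) * poly h (1 / x) = poly h x" if "x \<noteq> 0" "x \<noteq> 1" for x
  proof -
    have "x\<^sup>2 * (1 - 1 / x + (1 / x)\<^sup>2) = 1 - x + x\<^sup>2" using that by (simp add: field_simps power2_eq_square)
    then have "x ^ (2 * N) * (1 - 1 / x + (1 / x)\<^sup>2) ^ N = (1 - x + x\<^sup>2) ^ N"
      by (simp add: power_mult power_mult_distrib[symmetric])
    then show ?thesis unfolding h using less.prems(2)[OF that] by (simp add: algebra_simps)
  qed
  have "poly h 0 = 0" by (simp add: h)
  then obtain u where u: "h = [:0, 1:] * u" using poly_eq_0_iff_dvd[of h 0] by (auto elim: dvdE)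
  have "poly u 0 = 0"
  proof -
    \<comment> \<open>The map x -> x / (x - 1) is composed of 1 - x, 1 / x and 1 - x. Dividing
      \<open>h\<close> by x leaves the factor x - 1, which tends to -1 at 0, so the limit reads -
      u(0) = u(0).\<close>
    have eq: "poly u x * (x - 1) = (1 - x) ^ (2 * N) * poly u (x / (x - 1))" if "x \<noteq> 0" "x \<noteq> 1" for x
    proof -
      have "1 - x \<noteq> 0" "1 - x \<noteq> 1" "1 / (1 - x) \<noteq> 0" using that by auto
      have "1 - 1 / (1 - x) = x / (x - 1)" using that by (simp add: field_simps)
      then have "poly h x = (1 - x) ^ (2 * N) * poly h (x / (x - 1))"
        using h1[of x] h1[of "1 / (1 - x)"] h2[OF \<open>1 - x \<noteq> 0\<close> \<open>1 - x \<noteq> 1\<close>] by simp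
      then have "x * poly u x = (1 - x) ^ (2 * N) * (x / (x - 1) * poly u (x / (x - 1)))"
        by (simp add: u)
      then have "x * (poly u x * (x - 1)) = x * ((1 - x) ^ (2 * N) * poly u (x / (x - 1)))"
        using that by (simp add: field_simps)
      then show ?thesis using that by simp
    qed
    have lim1: "((\<lambda>x. poly u x * (x - 1)) \<longlongrightarrow> poly u 0 * (0 - 1)) (at 0)"
      by (intro tendsto_intros)
    have lim2: "((\<lambda>x. (1 - x) ^ (2 * N) * poly u (x / (x - 1))) \<longlongrightarrow> (1 - 0) ^ (2 * N) * poly u (0 / (0 - 1))) (at 0)"
      by (intro tendsto_intros) auto
    have "\<forall>\<^sub>F x in at 0. poly u x * (x - 1) = (1 - x) ^ (2 * N) * poly u (x / (x - 1))"
    proof -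
      have "\<forall>\<^sub>F x in at (0::complex). x \<noteq> 1"
        by (intro tendsto_imp_eventually_ne[of "\<lambda>x. x" 0]) auto
      moreover have "\<forall>\<^sub>F x in at (0::complex). x \<noteq> 0" by (simp add: eventually_at_filter)
      ultimately show ?thesis by eventually_elim (rule eq)
    qed
    from tendsto_unique[OF at_neq_bot iffD1[OF tendsto_cong[OF this] lim1] lim2]
    have "poly u 0 * (0 - 1) = (1 - 0) ^ (2 * N) * poly u (0 / (0 - 1))" .
    then show ?thesis by simp
  qed
  then obtain u' where u': "u = [:0, 1:] * u'" using poly_eq_0_iff_dvd[of u 0] by (auto elim: dvdE)
  have h_dvd: "h = [:0, 1:]\<^sup>2 * u'" unfolding u u' by (simp add: power2_eq_square mult.assoc)
  have "h = [:1, -1:]\<^sup>2 * pcompose u' [:1, -1:]"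
  proof (rule poly_eqI_cofinite[of "{}"])
    fix x
    have "poly h x = poly h (1 - x)" by (simp add: h1)
    also have "\<dots> = (1 - x)\<^sup>2 * poly u' (1 - x)" unfolding u u' by (simp add: power2_eq_square)
    finally show "poly h x = poly ([:1, -1:]\<^sup>2 * pcompose u' [:1, -1:]) x"
      by (simp add: poly_pcompose)
  qed simp
  \<comment> \<open>A Bezout identity for x^2 and (1 - x)^2: since both divide \<open>h\<close>, so
    does their product.\<close>
  moreover have "[:0, 1:]\<^sup>2 * [:3, -2:] + [:1, -1:]\<^sup>2 * [:1, 2:] = (1 :: complex poly)"
    by (simp add: power2_eq_square one_pCons)
  ultimately have "h = [:0, 1:]\<^sup>2 * [:1, -1:]\<^sup>2 * ([:3, -2:] * pcompose u' [:1, -1:] + [:1, 2:] * u')"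
    using h_dvd by Groebner_Basis.algebra
  then obtain w where w: "h = [:0, 1:]\<^sup>2 * [:1, -1:]\<^sup>2 * w" ..
  have hw: "poly h x = (x * (1 - x))\<^sup>2 * poly w x" for x
    unfolding w by (simp add: power_mult_distrib)
  have w1: "poly w (1 - x) = poly w x" for x
  proof -
    have "pcompose w [:1, -1:] = w"
    proof (rule poly_eqI_cofinite[of "{0, 1}"])
      fix x :: complex assume "x \<notin> {0, 1}"
      then have "(x * (1 - x))\<^sup>2 \<noteq> 0" by auto
      moreover have "(x * (1 - x))\<^sup>2 * poly w (1 - x) = (x * (1 - x))\<^sup>2 * poly w x"
        using h1[of x] by (simp add: hw mult.commute[of x])
      ultimately show "poly (pcompose w [:1, -1:]) x = poly w x"
        by (simp add: poly_pcompose)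
    qed simp
    then have "poly (pcompose w [:1, -1:]) x = poly w x" by simp
    then show ?thesis by (simp add: poly_pcompose)
  qed
  \<comment> \<open>Splitting off (x (1 - x))^2 lowers the weight 2 N by 6, which is the passage to
    N - 3. The cases of small \<open>N\<close> are caught by \<open>poly_reciprocal_degree\<close>:
    a nonzero quotient forces N \<ge> 3.\<close>
  have w2: "x ^ (2 * N) * poly w (1 / x) = x ^ 6 * poly w x" if "x \<noteq> 0" "x \<noteq> 1" for x
  proof -
    have nz: "(x * (1 - x))\<^sup>2 \<noteq> 0" using that by auto
    have "x ^ 6 * (1 / x * (1 - 1 / x))\<^sup>2 = (x * (1 - x))\<^sup>2"
      using that by (simp add: field_simps power2_eq_square eval_nat_numeral)
    then have "(x * (1 - x))\<^sup>2 * (x ^ (2 * N) * poly w (1 / x)) = x ^ 6 * (x ^ (2 * N) * poly h (1 / x))"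
      by (simp add: hw mult_ac)
    also have "\<dots> = (x * (1 - x))\<^sup>2 * (x ^ 6 * poly w x)"
      using h2[OF that] by (simp add: hw mult_ac)
    finally show ?thesis using nz by simp
  qed
  show ?case
  proof (cases "w = 0")
    case True
    then have "\<exists>a. \<forall>x. poly g x = a * (1 - x + x\<^sup>2) ^ N"
    proof (intro exI allI)
      fix x
      have "poly g x - poly g 0 * (1 - x + x\<^sup>2) ^ N = 0"
        unfolding h[symmetric] hw True by simp
      then show "poly g x = poly g 0 * (1 - x + x\<^sup>2) ^ N" by (rule iffD1[OF right_minus_eq])
    qed
    then obtain a where "\<And>x. poly g x = a * (1 - x + x\<^sup>2) ^ N" by blast
    then show ?thesis
      by (intro exI[of _ "\<lambda>j. if j = 0 then a else 0"]) (simp add: sum.atMost_shift)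
  next
    case False
    then have N: "3 \<le> N" using poly_reciprocal_degree[OF False w2] by simp
    have "x ^ (2 * (N - 3)) * poly w (1 / x) = poly w x" if "x \<noteq> 0" "x \<noteq> 1" for x
    proof -
      have "2 * N = 6 + 2 * (N - 3)" using N by simp
      then have "x ^ 6 * (x ^ (2 * (N - 3)) * poly w (1 / x)) = x ^ 6 * poly w x"
        using w2[OF that] by (simp add: power_add mult.assoc)
      then show ?thesis using that by simp
    qed
    with less.IH[of "N - 3" w] w1 N obtain c where
      c: "\<And>x. poly w x = (\<Sum>j\<le>(N - 3) div 3. c j * (1 - x + x\<^sup>2) ^ (N - 3 - 3 * j) * (x * (1 - x)) ^ (2 * j))"
      by auto
    have Ndiv: "N div 3 = Suc ((N - 3) div 3)" using N by simp
    define c' where "c' = (\<lambda>j. case j of 0 \<Rightarrow> poly g 0 | Suc j \<Rightarrow> c j)"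
    have "poly g x = (\<Sum>j\<le>N div 3. c' j * (1 - x + x\<^sup>2) ^ (N - 3 * j) * (x * (1 - x)) ^ (2 * j))" for x
    proof -
      have "poly g x = poly g 0 * (1 - x + x\<^sup>2) ^ N + (x * (1 - x))\<^sup>2 * poly w x"
        using h[of x] hw[of x] by simp
      also have "(x * (1 - x))\<^sup>2 * poly w x
        = (\<Sum>j\<le>(N - 3) div 3. c' (Suc j) * (1 - x + x\<^sup>2) ^ (N - 3 * Suc j) * (x * (1 - x)) ^ (2 * Suc j))"
        unfolding c sum_distrib_left c'_def by (intro sum.cong refl) (simp add: power_add mult_ac power2_eq_square)
      finally show ?thesis unfolding Ndiv sum.atMost_Suc_shift by (simp add: c'_def)
    qed
    then show ?thesis by blast
  qed
qed

text \<open>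
  The arguments correspond to the theta constants \<open>\<theta>_2, \<theta>_3, \<theta>_4\<close>; the modular curve is
  \<open>q^4 = p^4 + r^4\<close>, on which \<open>r^4 / q^4\<close> serves as the \<open>\<lambda>\<close>-function.
\<close>

definition theta_swe :: "nat \<Rightarrow> z4 vec set \<Rightarrow> complex \<Rightarrow> complex \<Rightarrow> complex \<Rightarrow> complex" where
  "theta_swe n C p q r = swe n C ((q + r) / 2) (p / 2) ((q - r) / 2)"

text \<open>In these coordinates the normalized MacWilliams transformation is just the exchange of
  \<open>p\<close> and \<open>r\<close>.\<close>

lemma theta_swe_swap:
  assumes "self_dual_code n C"
  shows "theta_swe n C r q p = theta_swe n C p q r"
proof -
  have "((q + r) / 2 + 2 * (p / 2) + (q - r) / 2) / 2 = (q + p) / 2" "((q + r) / 2 - (q - r) / 2) / 2 = r / 2"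
    "((q + r) / 2 - 2 * (p / 2) + (q - r) / 2) / 2 = (q - p) / 2"
    by (simp_all add: field_simps)
  with swe_self_dual[OF assms, of "(q + r) / 2" "p / 2" "(q - r) / 2"] show ?thesis
    by (simp only: theta_swe_def)
qed

lemma theta_swe_scale: "theta_swe n C (t * p) (t * q) (t * r) = t ^ n * theta_swe n C p q r"
  unfolding theta_swe_def swe_scale[symmetric] by (simp add: algebra_simps)

lemma type_II_subset: "type_II_code n C \<Longrightarrow> C \<subseteq> carrier_vec n"
  by (simp add: type_II_code_def self_dual_code_def z4_linear_code_def)

text \<open>The factor \<zeta> gives the sign (-1)^(units/4), the exchange of \<open>q\<close> and
  \<open>r\<close> gives (-1)^twos. The two cancel because the weight of a word is 4 (units/4 +
  twos) and divisible by 8.\<close>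

lemma theta_swe_rotate:
  assumes "type_II_code n C" "\<zeta> ^ 4 = -1"
  shows "theta_swe n C (\<zeta> * p) r q = theta_swe n C p q r"
proof -
  have "((r + q) / 2) ^ a * (\<zeta> * p / 2) ^ units c * ((r - q) / 2) ^ twos c
      = ((q + r) / 2) ^ a * (p / 2) ^ units c * ((q - r) / 2) ^ twos c" if "c \<in> C" for a c
  proof -
    note c = type_II_units[OF assms(1) that]
    have "(r - q) / 2 = -1 * ((q - r) / 2)" by simp
    then have "((r - q) / 2) ^ twos c = (-1) ^ twos c * ((q - r) / 2) ^ twos c"
      by (simp only: power_mult_distrib)
    moreover have "(\<zeta> * p / 2) ^ units c = (-1) ^ (units c div 4) * (p / 2) ^ units c"
    proof -
      have "\<zeta> ^ units c = (-1) ^ (units c div 4)"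
        by (subst c(1)) (simp add: power_mult assms(2))
      then show ?thesis by (simp add: power_mult_distrib flip: times_divide_eq_right)
    qed
    moreover have "(-1) ^ (units c div 4) * (-1) ^ twos c = (1 :: complex)"
      using c(2) by (simp flip: power_add)
    ultimately show ?thesis by (simp add: add.commute mult_ac)
  qed
  then show ?thesis
    unfolding theta_swe_def swe_eq_sum[OF type_II_subset[OF assms(1)]] by (intro sum.cong refl)
qed

lemma theta_swe_fourth_power:
  assumes "type_II_code n C" "p ^ 4 = p' ^ 4"
  shows "theta_swe n C p q r = theta_swe n C p' q r"
proof -
  have "(p / 2) ^ units c = (p' / 2) ^ units c" if "c \<in> C" for c
    by (subst (1 2) type_II_units(1)[OF assms(1) that]) (simp add: power_mult power_divide assms(2))
  then show ?thesis
    unfolding theta_swe_def swe_eq_sum[OF type_II_subset[OF assms(1)]] by (intro sum.cong refl) simp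
qed

lemma theta_swe_011:
  assumes "type_II_code n C"
  shows "theta_swe n C 0 t t = t ^ n"
  using swe_zero_word[of n C t] assms
  by (simp add: theta_swe_def type_II_code_def self_dual_code_def)

lemma obtain_fourth_root: obtains p :: complex where "p ^ 4 = a"
proof
  have "csqrt (csqrt a) ^ (2 * 2) = a" by (simp only: power_mult power2_csqrt)
  then show "csqrt (csqrt a) ^ 4 = a" by simp
qed

text \<open>Swap followed by rotation sends (p, q, r) to (\<zeta> r, p, q), and its cube multiplies
  all three arguments by \<zeta>. At (0,1,1) this gives \<zeta>^n = 1 for a number \<zeta> of order
  8.\<close>

lemma type_II_length:
  assumes "type_II_code n C"
  shows "8 dvd n"
proof -
  have sd: "self_dual_code n C" using assms by (simp add: type_II_code_def)
  obtain \<zeta> :: complex where \<zeta>: "\<zeta> ^ 4 = -1" by (rule obtain_fourth_root)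
  note T = theta_swe_rotate[OF assms \<zeta>] and S = theta_swe_swap[OF sd]
  have "theta_swe n C (\<zeta> * p) (\<zeta> * q) (\<zeta> * r) = theta_swe n C p q r" for p q r
    by (metis T S)
  from this[of 0 1 1] have 1: "\<zeta> ^ n = 1"
    by (simp add: theta_swe_011[OF assms])
  then have "(\<zeta> ^ n) ^ 4 = 1" by simp
  then have "(-1) ^ n = (1 :: complex)" by (simp add: \<zeta> flip: power_mult) (simp add: mult.commute[of n] power_mult \<zeta>)
  then have "even n" by (metis neg_one_odd_power one_neq_neg_one)
  then obtain m where m: "n = 2 * m" by (rule evenE)
  have "(\<zeta> ^ n) ^ 2 = 1" using 1 by simp
  then have "\<zeta> ^ (4 * m) = 1" by (simp add: m flip: power_mult)
  then have "(-1) ^ m = (1 :: complex)" by (simp add: power_mult \<zeta>)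
  then have "even m" by (metis neg_one_odd_power one_neq_neg_one)
  then obtain l where l: "m = 2 * l" by (rule evenE)
  have "\<zeta> ^ (4 * l) = 1" using 1 by (simp add: m l)
  then have "(-1) ^ l = (1 :: complex)" by (simp add: power_mult \<zeta>)
  then have "even l" by (metis neg_one_odd_power one_neq_neg_one)
  then show ?thesis by (auto simp: m l elim!: evenE)
qed

lemma poly_in_fourth_power:
  fixes M :: "complex poly"
  assumes "\<And>x. poly M (\<i> * x) = poly M x"
  obtains g where "\<And>x. poly M x = poly g (x ^ 4)"
proof
  have "pcompose M [:0, \<i>:] = M"
    by (rule poly_eqI_cofinite[of "{}"]) (simp_all add: poly_pcompose assms[unfolded mult.commute[of "\<i>"]])
  then have "\<i> ^ j * coeff M j = coeff M j" for j
    using coeff_pcompose_linear[of M "\<i>" j] by simp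
  then have zero: "coeff M j = 0" if "\<i> ^ j \<noteq> 1" for j using that by auto
  have zero: "coeff M j = 0" if "\<not> 4 dvd j" for j
  proof (rule zero)
    have "j mod 4 \<in> {1, 2, 3}" using that by (auto simp: dvd_eq_mod_eq_0)
    moreover have "\<i> ^ 1 \<noteq> 1" "\<i> ^ 2 \<noteq> 1" "\<i> ^ 3 \<noteq> 1"
      by (simp_all add: complex_eq_iff power3_eq_cube)
    ultimately have neq: "\<i> ^ (j mod 4) \<noteq> 1" by (elim insertE emptyE) (simp_all only: not_False_eq_True)
    have eq: "\<i> ^ j = \<i> ^ (j mod 4)"
    proof -
      have "\<i> ^ j = (\<i> ^ 4) ^ (j div 4) * \<i> ^ (j mod 4)" by (simp only: power_mult[symmetric] power_add[symmetric] mult_div_mod_eq)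
      then show ?thesis by simp
    qed
    show "\<i> ^ j \<noteq> 1" using neq by (subst eq)
  qed
  fix x
  have "poly M x = (\<Sum>j\<le>4 * degree M. coeff M j * x ^ j)"
    unfolding poly_altdef by (intro sum.mono_neutral_left) (auto simp: coeff_eq_0)
  also have "\<dots> = (\<Sum>j\<in>(*) 4 ` {..degree M}. coeff M j * x ^ j)"
  proof (intro sum.mono_neutral_right ballI)
    fix j assume "j \<in> {..4 * degree M} - (*) 4 ` {..degree M}"
    then have "\<not> 4 dvd j" by (auto elim!: dvdE)
    then show "coeff M j * x ^ j = 0" by (simp add: zero)
  qed auto
  also have "\<dots> = (\<Sum>l\<le>degree M. coeff M (4 * l) * (x ^ 4) ^ l)"
    by (subst sum.reindex) (auto simp: inj_on_def power_mult)
  also have "\<dots> = poly (\<Sum>l\<le>degree M. monom (coeff M (4 * l)) l) (x ^ 4)"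
    by (simp add: poly_sum poly_monom)
  finally show "poly M x = poly (\<Sum>l\<le>degree M. monom (coeff M (4 * l)) l) (x ^ 4)" .
qed

lemma theta_swe_polynomial:
  assumes "type_II_code n C"
  obtains M where "\<And>p r. p ^ 4 = 1 - r ^ 4 \<Longrightarrow> theta_swe n C p 1 r = poly M r"
proof
  let ?M = "\<Sum>c\<in>C. [:1/2, 1/2:] ^ (n - units c - twos c) * smult (1/16) (1 - [:0, 1:] ^ 4) ^ (units c div 4) * [:1/2, -1/2:] ^ twos c"
  fix p r :: complex assume pr: "p ^ 4 = 1 - r ^ 4"
  have "(p / 2) ^ units c = ((1 - r ^ 4) / 16) ^ (units c div 4)" if "c \<in> C" for c
    by (subst type_II_units(1)[OF assms that]) (simp add: power_mult power_divide pr)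
  then show "theta_swe n C p 1 r = poly ?M r"
    unfolding theta_swe_def swe_eq_sum[OF type_II_subset[OF assms]] poly_sum
    by (intro sum.cong refl) (simp add: poly_power diff_divide_distrib add_divide_distrib)
qed

text \<open>Only the fourth power of the first argument matters, and the swap carries this over to
  the third; so for q = 1 on the curve everything is a polynomial in r^4. Swap and rotation with
  rescaling then act on r^4 as x -> 1 - x and x -> 1 / x.\<close>

lemma theta_swe_hauptmodul:
  assumes "type_II_code n C"
  obtains g where "\<And>p r. p ^ 4 = 1 - r ^ 4 \<Longrightarrow> theta_swe n C p 1 r = poly g (r ^ 4)"
    "\<And>x. poly g (1 - x) = poly g x"
    "\<And>x. x \<noteq> 0 \<Longrightarrow> x ^ (2 * (n div 8)) * poly g (1 / x) = poly g x"
proof -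
  have sd: "self_dual_code n C" using assms by (simp add: type_II_code_def)
  obtain \<zeta> :: complex where \<zeta>: "\<zeta> ^ 4 = -1" by (rule obtain_fourth_root)
  note T = theta_swe_rotate[OF assms \<zeta>] and S = theta_swe_swap[OF sd]
    and F = theta_swe_fourth_power[OF assms]
  obtain M where M: "\<And>p r. p ^ 4 = 1 - r ^ 4 \<Longrightarrow> theta_swe n C p 1 r = poly M r"
    using theta_swe_polynomial[OF assms] by blast
  have "poly M (\<i> * r) = poly M r" for r
  proof -
    obtain p where p: "p ^ 4 = 1 - r ^ 4" by (rule obtain_fourth_root)
    then have "p ^ 4 = 1 - (\<i> * r) ^ 4" by (simp add: power_mult_distrib)
    then have "poly M (\<i> * r) = theta_swe n C p 1 (\<i> * r)" by (rule M[symmetric])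
    also have "\<dots> = theta_swe n C (\<i> * r) 1 p" by (rule S)
    also have "\<dots> = theta_swe n C r 1 p" by (rule F) (simp add: power_mult_distrib)
    also have "\<dots> = poly M r" using M[OF p] by (simp add: S)
    finally show ?thesis .
  qed
  then obtain g where g: "\<And>x. poly M x = poly g (x ^ 4)" using poly_in_fourth_power by blast
  have gM: "theta_swe n C p 1 r = poly g (r ^ 4)" if "p ^ 4 = 1 - r ^ 4" for p r
    using M[OF that] g by simp
  show thesis
  proof (rule that[of g])
    show "theta_swe n C p 1 r = poly g (r ^ 4)" if "p ^ 4 = 1 - r ^ 4" for p r
      using gM[OF that] .
    fix x :: complex
    obtain r where r: "r ^ 4 = x" by (rule obtain_fourth_root)
    obtain p where p: "p ^ 4 = 1 - x" by (rule obtain_fourth_root)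
    show "poly g (1 - x) = poly g x"
      using gM[of p r] gM[of r p] S[of r 1 p] by (simp add: r p)
    assume x: "x \<noteq> 0"
    then have r0: "r \<noteq> 0" using r by auto
    have n: "n = 4 * (2 * (n div 8))" using type_II_length[OF assms] by simp
    have "theta_swe n C p 1 r = theta_swe n C (\<zeta> * p) r 1" by (simp add: T)
    also have "\<dots> = theta_swe n C (r * (\<zeta> * p / r)) (r * 1) (r * (1 / r))" using r0 by simp
    also have "\<dots> = r ^ n * theta_swe n C (\<zeta> * p / r) 1 (1 / r)" by (rule theta_swe_scale)
    also have "theta_swe n C (\<zeta> * p / r) 1 (1 / r) = poly g (1 / x)"
      by (subst gM) (use r0 x in \<open>simp_all add: power_divide power_mult_distrib \<zeta> p r field_simps\<close>)
    also have "r ^ n = x ^ (2 * (n div 8))" by (subst n) (simp only: power_mult r)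
    finally show "x ^ (2 * (n div 8)) * poly g (1 / x) = poly g x"
      using gM[of p r] by (simp add: r p)
  qed
qed

section \<open>From the modular curve to the identity of power series\<close>

lemma fps_of_poly_half: "fps_of_poly [:1/2, 1/2:] = fps_const (1/2) * (1 + fps_X :: real fps)"
  by (simp add: fps_of_poly_pCons algebra_simps)

lemma fps_of_poly_eis: "fps_of_poly [:1, 60, 134, 60, 1:] = eis_fps"
proof -
  have "fps_of_poly [:a, b, c, d, e:] = fps_const a + fps_const b * fps_X + fps_const c * fps_X ^ 2
      + fps_const d * fps_X ^ 3 + fps_const e * fps_X ^ 4" for a b c d e :: real
    by (simp only: fps_of_poly_pCons fps_of_poly_0) Groebner_Basis.algebra
  then show ?thesis by (simp add: eis_fps_def numeral_fps_const)
qed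

lemma fps_of_poly_cusp: "fps_of_poly ([:0, 1:] * [:1, 1:]\<^sup>2 * [:1, -1:] ^ 8) = cusp_fps"
  unfolding cusp_fps_def fps_of_poly_mult fps_of_poly_power
  by (simp add: fps_of_poly_pCons)

text \<open>For x = 1 and z = V the theta coordinates are q = 1 + V and r = 1 - V, so
  \<open>u\<close> is r^4 / q^4. The point V = 0 of the zero word is the cusp u = 1.\<close>

lemma theta_swe_cusp_expansion:
  fixes V :: complex
  defines "u \<equiv> ((1 - V) / (1 + V)) ^ 4"
  assumes "1 + V \<noteq> 0"
  shows "(1 + V) ^ 8 * (1 - u + u\<^sup>2) = 1 + 60 * V^2 + 134 * V^4 + 60 * V^6 + V^8"
    "(1 + V) ^ 24 * (u * (1 - u))\<^sup>2 = 64 * (V^2 * (1 + V^2)^2 * (1 - V^2)^8)"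
proof -
  define a b where "a = (1 - V) ^ 4" and "b = (1 + V) ^ 4"
  have b: "b \<noteq> 0" using assms(2) by (simp add: b_def)
  have l: "u * b = a" using assms(2) by (simp add: u_def a_def b_def power_divide)
  have "(1 + V) ^ 8 = b\<^sup>2" "(1 + V) ^ 24 = b ^ 6" by (simp_all add: b_def flip: power_mult)
  moreover have "b\<^sup>2 * (1 - u + u\<^sup>2) = b\<^sup>2 - a * b + a\<^sup>2" unfolding l[symmetric] by Groebner_Basis.algebra
  moreover have "b ^ 6 * (u * (1 - u))\<^sup>2 = (a * b)\<^sup>2 * (b - a)\<^sup>2" unfolding l[symmetric] by Groebner_Basis.algebra
  moreover have "b\<^sup>2 - a * b + a\<^sup>2 = 1 + 60 * V^2 + 134 * V^4 + 60 * V^6 + V^8"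
    unfolding a_def b_def by Groebner_Basis.algebra
  moreover have "b - a = 8 * V * (1 + V^2)" unfolding a_def b_def by Groebner_Basis.algebra
  moreover have "a * b = (1 - V^2)^4" unfolding a_def b_def by Groebner_Basis.algebra
  moreover have "((1 - V^2)^4)\<^sup>2 * (8 * V * (1 + V^2))\<^sup>2 = 64 * (V^2 * (1 + V^2)^2 * (1 - V^2)^8)"
    by (simp add: power_mult_distrib flip: power_mult)
  ultimately show "(1 + V) ^ 8 * (1 - u + u\<^sup>2) = 1 + 60 * V^2 + 134 * V^4 + 60 * V^6 + V^8"
    "(1 + V) ^ 24 * (u * (1 - u))\<^sup>2 = 64 * (V^2 * (1 + V^2)^2 * (1 - V^2)^8)"
    by simp_all
qed

text \<open>On the curve y^4 = V (1 + V^2) / 2 a word contributes V^(units/4 + twos) times ((1 +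
  V^2) / 2)^(units/4). The first exponent is a quarter of the weight and even, so everything depends
  on s = V^2 only.\<close>

lemma type_II_real_identity:
  assumes "type_II_code n C"
  obtains c :: "nat \<Rightarrow> real" where
    "\<And>s. 0 \<le> s \<Longrightarrow> (\<Sum>w\<in>C. s ^ (euclidean_weight w div 8) * (1/2 + s/2) ^ (units w div 4))
       = (\<Sum>j\<le>n div 8 div 3. c j * (eis s ^ (n div 8 - 3 * j) * cusp s ^ j))"
proof -
  define N where "N = n div 8"
  have n: "n = 8 * N" using type_II_length[OF assms] by (simp add: N_def)
  obtain g where g: "\<And>p r. p ^ 4 = 1 - r ^ 4 \<Longrightarrow> theta_swe n C p 1 r = poly g (r ^ 4)"
    "\<And>x. poly g (1 - x) = poly g x"
    "\<And>x. x \<noteq> 0 \<Longrightarrow> x ^ (2 * N) * poly g (1 / x) = poly g x"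
    unfolding N_def using theta_swe_hauptmodul[OF assms] by blast
  from anharmonic_invariant_decomposition[of g N] g(2,3) obtain c where
    c: "\<And>x. poly g x = (\<Sum>j\<le>N div 3. c j * (1 - x + x\<^sup>2) ^ (N - 3 * j) * (x * (1 - x)) ^ (2 * j))"
    by blast
  show thesis
  \<comment> \<open>The invariant theory yields complex coefficients; as all other quantities are
    real, their real parts serve as well. The powers of 64 come from
    \<open>theta_swe_cusp_expansion\<close>.\<close>
  proof (rule that[of "\<lambda>j. Re (c j * 64 ^ j)"])
    fix s :: real assume s: "0 \<le> s"
    define v where "v = sqrt s"
    define V where "V = complex_of_real v"
    have v: "0 \<le> v" "v\<^sup>2 = s" using s by (simp_all add: v_def)
    have V2: "V\<^sup>2 = of_real s" by (simp add: V_def v flip: of_real_power)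
    have V1: "1 + V \<noteq> 0"
    proof -
      have "1 + V = of_real (1 + v)" by (simp add: V_def)
      then show ?thesis using v by (simp only: of_real_eq_0_iff)
    qed
    \<comment> \<open>This makes (2 y)^4 = (1 + V)^4 - (1 - V)^4, so that the point lies on the
      modular curve.\<close>
    obtain y where y: "y ^ 4 = V * (1 + V\<^sup>2) / 2" by (rule obtain_fourth_root)
    define r where "r = (1 - V) / (1 + V)"
    have words: "y ^ units w * V ^ twos w = of_real (s ^ (euclidean_weight w div 8) * (1/2 + s/2) ^ (units w div 4))"
      if "w \<in> C" for w
    proof -
      note w = type_II_units[OF assms that]
      define k where "k = euclidean_weight w div 8"
      from w(2) obtain l where l: "units w div 4 + twos w = 2 * l" by (rule evenE)
      then have k: "units w div 4 + twos w = 2 * k" by (simp add: k_def w(3))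
      have "y ^ units w = (V * (1 + V\<^sup>2) / 2) ^ (units w div 4)"
        by (subst w(1)) (simp add: power_mult y)
      also have "\<dots> = V ^ (units w div 4) * (1/2 + of_real s/2) ^ (units w div 4)"
        unfolding V2 by (simp add: add_divide_distrib flip: power_mult_distrib times_divide_eq_right)
      finally have "y ^ units w * V ^ twos w = V ^ (units w div 4 + twos w) * (1/2 + of_real s/2) ^ (units w div 4)"
        by (simp add: power_add mult_ac)
      also have "V ^ (units w div 4 + twos w) = of_real s ^ k" unfolding k power_mult V2 ..
      finally show ?thesis by (simp add: k_def)
    qed
    have "of_real (\<Sum>w\<in>C. s ^ (euclidean_weight w div 8) * (1/2 + s/2) ^ (units w div 4)) = swe n C 1 y V"
      unfolding swe_eq_sum[OF type_II_subset[OF assms]] of_real_sum by (intro sum.cong refl) (simp add: words)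
    also have "swe n C 1 y V = theta_swe n C (2 * y) (1 + V) (1 - V)"
      by (simp add: theta_swe_def)
    also have "\<dots> = theta_swe n C ((1 + V) * (2 * y / (1 + V))) ((1 + V) * 1) ((1 + V) * r)"
      using V1 by (simp add: r_def)
    also have "\<dots> = (1 + V) ^ n * theta_swe n C (2 * y / (1 + V)) 1 r"
      by (rule theta_swe_scale)
    also have "theta_swe n C (2 * y / (1 + V)) 1 r = poly g (r ^ 4)"
    proof (rule g(1))
      have "16 * y ^ 4 = (1 + V) ^ 4 - (1 - V) ^ 4" unfolding y by Groebner_Basis.algebra
      then have "16 * y ^ 4 / (1 + V) ^ 4 = 1 - (1 - V) ^ 4 / (1 + V) ^ 4"
        using V1 by (simp add: diff_divide_distrib)
      then show "(2 * y / (1 + V)) ^ 4 = 1 - r ^ 4"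
        unfolding r_def power_divide power_mult_distrib by simp
    qed
    also have "(1 + V) ^ n * poly g (r ^ 4) = (\<Sum>j\<le>N div 3. c j * 64 ^ j * of_real (eis s ^ (N - 3 * j) * cusp s ^ j))"
      unfolding c sum_distrib_left
    proof (intro sum.cong refl)
      fix j assume "j \<in> {..N div 3}"
      then have j: "8 * N = 8 * (N - 3 * j) + 24 * j" by auto
      have pow: "(1 + V) ^ n = ((1 + V) ^ 8) ^ (N - 3 * j) * ((1 + V) ^ 24) ^ j"
        unfolding n j power_add power_mult ..
      have e: "(1 + V) ^ 8 * (1 - r ^ 4 + (r ^ 4)\<^sup>2) = of_real (eis s)"
        unfolding r_def theta_swe_cusp_expansion(1)[OF V1] by (simp add: eis_def flip: V2 power_mult)
      have d: "(1 + V) ^ 24 * (r ^ 4 * (1 - r ^ 4))\<^sup>2 = 64 * of_real (cusp s)"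
        unfolding r_def theta_swe_cusp_expansion(2)[OF V1] by (simp add: cusp_def flip: V2)
      have "(1 + V) ^ n * (c j * (1 - r ^ 4 + (r ^ 4)\<^sup>2) ^ (N - 3 * j) * (r ^ 4 * (1 - r ^ 4)) ^ (2 * j))
         = c j * ((1 + V) ^ 8 * (1 - r ^ 4 + (r ^ 4)\<^sup>2)) ^ (N - 3 * j) * ((1 + V) ^ 24 * (r ^ 4 * (1 - r ^ 4))\<^sup>2) ^ j"
      proof -
        have "(A ^ a * B ^ b) * (d * E ^ a * X ^ (2 * b)) = d * (A * E) ^ a * (B * X\<^sup>2) ^ b"
          for A B d E X :: complex and a b
          by (simp only: power_mult_distrib power_mult) (simp only: mult_ac)
        then show ?thesis unfolding pow .
      qed
      also have "\<dots> = c j * 64 ^ j * of_real (eis s ^ (N - 3 * j) * cusp s ^ j)"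
        unfolding e d by (simp add: power_mult_distrib)
      finally show "(1 + V) ^ n * (c j * (1 - r ^ 4 + (r ^ 4)\<^sup>2) ^ (N - 3 * j) * (r ^ 4 * (1 - r ^ 4)) ^ (2 * j))
         = c j * 64 ^ j * of_real (eis s ^ (N - 3 * j) * cusp s ^ j)" .
    qed
    finally have "Re (of_real (\<Sum>w\<in>C. s ^ (euclidean_weight w div 8) * (1/2 + s/2) ^ (units w div 4)))
      = Re (\<Sum>j\<le>N div 3. c j * 64 ^ j * of_real (eis s ^ (N - 3 * j) * cusp s ^ j))" by (rule arg_cong)
    then show "(\<Sum>w\<in>C. s ^ (euclidean_weight w div 8) * (1/2 + s/2) ^ (units w div 4))
       = (\<Sum>j\<le>n div 8 div 3. Re (c j * 64 ^ j) * (eis s ^ (n div 8 - 3 * j) * cusp s ^ j))"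
      unfolding N_def[symmetric] Re_sum Re_complex_of_real
      by (simp only: Re_complex_of_real times_complex.sel Im_complex_of_real mult_zero_right diff_zero)
  qed
qed

text \<open>Both sides are polynomials that agree on the nonnegative reals, hence as power series;
  the term 1 is the zero word.\<close>

lemma type_II_fps_identity:
  assumes "type_II_code n C"
  shows "\<exists>c. 1 + (\<Sum>w\<in>C - {0\<^sub>v n}. word_fps (euclidean_weight w div 8) (units w div 4))
    = (\<Sum>j\<le>n div 8 div 3. fps_const (c j) * (eis_fps ^ (n div 8 - 3 * j) * cusp_fps ^ j))"
proof -
  have sub: "C \<subseteq> carrier_vec n" and zero: "0\<^sub>v n \<in> C"
    using assms by (auto simp: type_II_code_def self_dual_code_def z4_linear_code_def)
  have fin: "finite C" using sub finite_carrier_vec_z4 by (rule finite_subset)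
  obtain c where c: "\<And>s. 0 \<le> s \<Longrightarrow> (\<Sum>w\<in>C. s ^ (euclidean_weight w div 8) * (1/2 + s/2) ^ (units w div 4))
       = (\<Sum>j\<le>n div 8 div 3. c j * (eis s ^ (n div 8 - 3 * j) * cusp s ^ j))"
    using type_II_real_identity[OF assms] by blast
  define P where "P = (\<Sum>w\<in>C. monom 1 (euclidean_weight w div 8) * [:1/2, 1/2:] ^ (units w div 4) :: real poly)"
  define Q where "Q = (\<Sum>j\<le>n div 8 div 3. smult (c j) ([:1, 60, 134, 60, 1:] ^ (n div 8 - 3 * j) * ([:0, 1:] * [:1, 1:]\<^sup>2 * [:1, -1:] ^ 8) ^ j))"
  have "P = Q"
  proof (rule ccontr)
    assume "P \<noteq> Q"
    then have "finite {s. poly (P - Q) s = 0}" by (intro poly_roots_finite) simp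
    moreover have "{0..} \<subseteq> {s. poly (P - Q) s = 0}"
    proof safe
      fix s :: real assume s: "0 \<le> s"
      have "poly [:1, 60, 134, 60, 1:] s = eis s" by (simp add: eis_def algebra_simps eval_nat_numeral)
      moreover have "poly ([:0, 1:] * [:1, 1:]\<^sup>2 * [:1, -1:] ^ 8) s = cusp s"
        by (simp add: cusp_def)
      ultimately have "poly Q s = (\<Sum>j\<le>n div 8 div 3. c j * (eis s ^ (n div 8 - 3 * j) * cusp s ^ j))"
        unfolding Q_def by (simp only: poly_sum poly_smult poly_mult poly_power)
      moreover have "poly P s = (\<Sum>w\<in>C. s ^ (euclidean_weight w div 8) * (1/2 + s/2) ^ (units w div 4))"
        unfolding P_def by (simp add: poly_sum poly_monom poly_power)
      ultimately show "poly (P - Q) s = 0" using c[OF s] by simp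
    qed
    ultimately have "finite {0::real..}" by (rule rev_finite_subset)
    then show False by (simp add: infinite_Ici)
  qed
  then have PQ: "fps_of_poly P = fps_of_poly Q" by simp
  have "fps_of_poly P = (\<Sum>w\<in>C. word_fps (euclidean_weight w div 8) (units w div 4))"
    unfolding P_def fps_of_poly_sum fps_of_poly_mult fps_of_poly_power fps_of_poly_monom' fps_of_poly_half word_fps_def ..
  also have "\<dots> = 1 + (\<Sum>w\<in>C - {0\<^sub>v n}. word_fps (euclidean_weight w div 8) (units w div 4))"
  proof -
    have "euclidean_weight (0\<^sub>v n) = 0" "units (0\<^sub>v n) = 0"
      by (simp_all add: euclidean_weight_def euclidean_weight_z4_def units_def)
    then show ?thesis by (subst sum.remove[OF fin zero]) (simp add: word_fps_def)
  qed
  finally have lhs: "fps_of_poly P = 1 + (\<Sum>w\<in>C - {0\<^sub>v n}. word_fps (euclidean_weight w div 8) (units w div 4))" .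
  have rhs: "fps_of_poly Q = (\<Sum>j\<le>n div 8 div 3. fps_const (c j) * (eis_fps ^ (n div 8 - 3 * j) * cusp_fps ^ j))"
    unfolding Q_def fps_of_poly_sum fps_of_poly_smult fps_of_poly_cusp[symmetric] fps_of_poly_eis[symmetric]
    by (simp only: fps_of_poly_mult fps_of_poly_power)
  show ?thesis by (rule exI[of _ c], rule trans[OF trans[OF lhs[symmetric] PQ] rhs])
qed

theorem theorem5:
  fixes n :: "nat \<Rightarrow> nat" and C :: "nat \<Rightarrow> z4 vec set"
  assumes "\<And>i. type_II_code (n i) (C i)"
    and "filterlim n at_top sequentially"
  shows "\<exists>x::real. x > 0 \<and> bound_poly x = 0 \<and> (\<forall>y>0. bound_poly y = 0 \<longrightarrow> y = x) \<and>
           limsup (\<lambda>i. ereal (real (min_euclidean_weight (n i) (C i)) / real (n i)))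
             \<le> ereal (2 - 2 * x) \<and>
           \<bar>(2 - 2 * x) - 0.3332625492\<bar> < 1 / 10 ^ 10"
proof -
  obtain s x :: real where s: "0 < s" "s < 1/1000" "eis s ^ 3 * cusp saddle = eis saddle ^ 3 * cusp s"
    and x: "0 < x" "bound_poly x = 0" "6 * x - 5 = s * (6 + 10 * s) / (1 - s\<^sup>2)"
    using obtain_conjugate_point by metis
  \<comment> \<open>For length \<open>8 N\<close> and weight \<open>8 k\<close> the relative weight
    is k / N, so the threshold of \<open>no_large_gap\<close> is directly the bound for the limit
    superior.\<close>
  have rate: "(1 - s * (6 + 10 * s) / (1 - s\<^sup>2)) / 3 = 2 - 2 * x"
    unfolding x(3)[symmetric] by simp
  have "limsup (\<lambda>i. ereal (real (min_euclidean_weight (n i) (C i)) / real (n i))) \<le> ereal (2 - 2 * x) + ereal \<epsilon>"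
    if \<epsilon>: "0 < \<epsilon>" for \<epsilon>
  proof -
    obtain N0 where N0: "\<forall>N\<ge>N0. \<forall>(W :: z4 vec set) k b c.
        (\<forall>w\<in>W. b w \<le> 2 * k w \<and> b w \<le> 2 * N \<and> (2 - 2 * x + \<epsilon>) * real N \<le> real (k w)) \<longrightarrow>
        1 + (\<Sum>w\<in>W. word_fps (k w) (b w)) \<noteq>
          (\<Sum>j\<le>N div 3. fps_const (c j) * (eis_fps ^ (N - 3 * j) * cusp_fps ^ j))"
      using no_large_gap[OF s \<epsilon>, where 'a = "z4 vec", unfolded rate] by (rule exE)
    have "\<forall>\<^sub>F i in sequentially. n i \<ge> max (8 * N0) 1"
      using assms(2) unfolding filterlim_at_top by (rule spec)
    then have "\<forall>\<^sub>F i in sequentially. ereal (real (min_euclidean_weight (n i) (C i)) / real (n i)) \<le> ereal (2 - 2 * x + \<epsilon>)"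
    proof eventually_elim
      case (elim i)
      define N where "N = n i div 8"
      have n: "n i = 8 * N" using type_II_length[OF assms(1)] by (simp add: N_def)
      have "N0 \<le> N" "0 < N" using elim by (auto simp: n)
      have sub: "C i \<subseteq> carrier_vec (n i)"
        by (rule type_II_subset[OF assms(1)])
      then have fin: "finite (C i)" using finite_carrier_vec_z4 by (rule finite_subset)
      show ?case
      proof (rule ccontr)
        assume "\<not> ?case"
        then have "2 - 2 * x + \<epsilon> < real (min_euclidean_weight (n i) (C i)) / real (n i)" by simp
        then have large: "(2 - 2 * x + \<epsilon>) * real (n i) < real (min_euclidean_weight (n i) (C i))"
          using elim by (simp add: pos_less_divide_eq)
        obtain c where c: "1 + (\<Sum>w\<in>C i - {0\<^sub>v (n i)}. word_fps (euclidean_weight w div 8) (units w div 4))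
            = (\<Sum>j\<le>N div 3. fps_const (c j) * (eis_fps ^ (N - 3 * j) * cusp_fps ^ j))"
          unfolding N_def using type_II_fps_identity[OF assms(1)] by blast
        have "\<forall>w\<in>C i - {0\<^sub>v (n i)}. units w div 4 \<le> 2 * (euclidean_weight w div 8) \<and> units w div 4 \<le> 2 * N \<and>
            (2 - 2 * x + \<epsilon>) * real N \<le> real (euclidean_weight w div 8)"
        proof
          fix w assume w: "w \<in> C i - {0\<^sub>v (n i)}"
          note u = type_II_units[OF assms(1), of w i]
          have "dim_vec w = 8 * N" using w sub n by auto
          then have "units w div 4 \<le> 2 * N" using units_twos_le[of w] by linarith
          moreover have wt: "euclidean_weight w = 8 * (euclidean_weight w div 8)"
            using assms(1)[of i] w by (auto simp: type_II_code_def)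
          moreover have "units w div 4 \<le> 2 * (euclidean_weight w div 8)"
            using wt u(3) w by auto
          moreover have "min_euclidean_weight (n i) (C i) \<le> euclidean_weight w"
            unfolding min_euclidean_weight_def using w fin by (intro Min_le) auto
          then have "(2 - 2 * x + \<epsilon>) * real (8 * N) < real (euclidean_weight w)"
            using large unfolding n by linarith
          then have "(2 - 2 * x + \<epsilon>) * real N \<le> real (euclidean_weight w div 8)"
            by (subst (asm) wt) simp
          ultimately show "units w div 4 \<le> 2 * (euclidean_weight w div 8) \<and> units w div 4 \<le> 2 * N \<and>
            (2 - 2 * x + \<epsilon>) * real N \<le> real (euclidean_weight w div 8)" by blast
        qed
        from N0[rule_format, OF \<open>N0 \<le> N\<close>, of "C i - {0\<^sub>v (n i)}" "\<lambda>w. units w div 4" "\<lambda>w. euclidean_weight w div 8" c] this c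
        show False by blast
      qed
    qed
    then show ?thesis by (simp add: Limsup_bounded)
  qed
  then have limsup_le: "limsup (\<lambda>i. ereal (real (min_euclidean_weight (n i) (C i)) / real (n i))) \<le> ereal (2 - 2 * x)"
    by (rule ereal_le_epsilon2)
  show ?thesis
  proof (intro exI[of _ x] conjI allI impI)
    show "y = x" if "0 < y" "bound_poly y = 0" for y
      using x(1) that(1) x(2) that(2) by (rule bound_poly_root_unique)
    show "\<bar>(2 - 2 * x) - 0.3332625492\<bar> < 1 / 10 ^ 10"
      using x(1,2) by (rule bound_poly_root_approx)
  qed (rule x limsup_le)+
qed

end
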